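(* Fix $n$. Let $\rho(\cdot,y)$ be convex for each $y\in\{0,1\}$ and satisfy the Lipschitz condition: there is $L>0$ such that $|\rho(b_1,y)-\rho(b_2,y)|\le L|b_1-b_2|$ for all $b_1,b_2\in\mathbb{R}$, $y\in\{0,1\}$. Assume that $X_{ij}$, $j\ge1$, are subgaussian $Subg(\sigma_{jn}^2)$ with $\sigma_{jn}\le s_n$. Then for all $r,t>0$: 1. $P(S(r)>t)\le\dfrac{8Lrs_n\sqrt{\log(p_n\vee2)}}{t\sqrt n}$; 2. $P(S_1(r)\ge t)\le\dfrac{8Lrs_n\sqrt{k_n\ln(p_n\vee2)}}{t\sqrt n}$; 3. $P(S_2(r)\ge t)\le\dfrac{4Lrs_n\sqrt{|s^*|}}{t\sqrt n}$.
   Context: $(X,Y)$ is a random element of $\mathbb{R}^{p_n}\times\{0,1\}$ (its law may depend on $n$) and $(X_i,Y_i)$, $i=1,\dots,n$, are iid copies of it, $X_i=(X_{i1},\dots,X_{ip_n})^T$. A random variable $Z$ is $Subg(\sigma^2)$ if $E\exp(tZ)\le\exp(t^2\sigma^2/2)$ for all $t\in\mathbb{R}$. Standing assumption: no nontrivial linear combination of the coordinates of $X$ is almost surely constant. For $\rho:\mathbb{R}\times\{0,1\}\to\mathbb{R}$ the risk and the empirical risk are $R(b)=E\rho(b^TX,Y)$ and $R_n(b)=\frac1n\sum_{i=1}^n\rho(b^TX_i,Y_i)$, $b\in\mathbb{R}^{p_n}$. $\beta^*=\arg\min_{b\in\mathbb{R}^{p_n}}R(b)$ is assumed throughout to exist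 and be unique; $s^*=\operatorname{supp}\beta^*=\{i:\beta^*_i\ne0\}$. Put $W(b)=R(b)-R(\beta^* )$, $W_n(b)=R_n(b)-R_n(\beta^* )$, and $B_p(r)=\{\Delta\in\mathbb{R}^{p_n}:\|\Delta\|_p\le r\}$ for $p=1,2$. $k_n$ is a deterministic positive integer and $\mathcal{M}\subseteq2^{\{1,\dots,p_n\}}$ is an arbitrary, possibly data-dependent (random), family of subsets such that almost surely $s^*\in\mathcal{M}$ and $|w|\le k_n$ for all $w\in\mathcal{M}$. Let $$D_1=\{b\in\mathbb{R}^{p_n}:\exists w\in\mathcal{M},\ |w|\le k_n,\ s^*\subseteq w,\ \operatorname{supp}b\subseteq w\},\qquad D_2=\{b\in\mathbb{R}^{p_n}:\operatorname{supp}b\subseteq s^*\},$$ $$S(r)=\sup_{b:\,b-\beta^*\in B_1(r)}|W(b)-W_n(b)|,\qquad S_k(r)=\sup_{b\in D_k:\,b-\beta^*\in B_2(r)}|W_n(b)-W(b)|,\quad k=1,2.$$ $a\vee b=\max(a,b)$. *)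

theory Defs
  imports "HOL-Probability.Probability"
begin

definition subgaussian :: "'a measure \<Rightarrow> ('a \<Rightarrow> real) \<Rightarrow> real \<Rightarrow> bool" where
  "subgaussian M Z v \<longleftrightarrow> (\<forall>t. integrable M (\<lambda>\<omega>. exp (t * Z \<omega>)) \<and>
     (\<integral>\<omega>. exp (t * Z \<omega>) \<partial>M) \<le> exp (t\<^sup>2 * v / 2))"

text \<open>Labels in \<open>{0,1}\<close> are naturals. Random labels take values in \<^term>\<open>count_space {0,1::nat}\<close>,
  so the values of \<open>\<rho> u y\<close> for \<open>y > 1\<close> play no role.\<close>

abbreviation obs_space :: "((real^'p) \<times> nat) measure" where
  "obs_space \<equiv> borel \<Otimes>\<^sub>M count_space {0,1}"

definition risk :: "'a measure \<Rightarrow> ('a \<Rightarrow> real^'p) \<Rightarrow> ('a \<Rightarrow> nat) \<Rightarrow> (real \<Rightarrow> nat \<Rightarrow> real)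
    \<Rightarrow> real^'p \<Rightarrow> real" where
  "risk M X Y \<rho> b = (\<integral>\<omega>. \<rho> (b \<bullet> X \<omega>) (Y \<omega>) \<partial>M)"

definition emp_risk :: "nat \<Rightarrow> (nat \<Rightarrow> 'a \<Rightarrow> real^'p) \<Rightarrow> (nat \<Rightarrow> 'a \<Rightarrow> nat) \<Rightarrow> (real \<Rightarrow> nat \<Rightarrow> real)
    \<Rightarrow> 'a \<Rightarrow> real^'p \<Rightarrow> real" where
  "emp_risk n Xs Ys \<rho> \<omega> b = (1 / real n) * (\<Sum>i=1..n. \<rho> (b \<bullet> Xs i \<omega>) (Ys i \<omega>))"

text \<open>Applied to the risk and to the empirical risk, this gives \<open>W\<close> and \<open>W\<^sub>n\<close>.\<close>

definition excess :: "(real^'p \<Rightarrow> real) \<Rightarrow> real^'p \<Rightarrow> real^'p \<Rightarrow> real" where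
  "excess R \<beta> b = R b - R \<beta>"

definition supp :: "real^'p \<Rightarrow> 'p set" where
  "supp b = {i. b $ i \<noteq> 0}"

definition l1_ball :: "real \<Rightarrow> (real^'p) set" where
  "l1_ball r = {\<Delta>. (\<Sum>i\<in>UNIV. \<bar>\<Delta> $ i\<bar>) \<le> r}"

definition l2_ball :: "real \<Rightarrow> (real^'p) set" where
  "l2_ball r = {\<Delta>. norm \<Delta> \<le> r}"

definition D1 :: "real^'p \<Rightarrow> nat \<Rightarrow> 'p set set \<Rightarrow> (real^'p) set" where
  "D1 \<beta> k F = {b. \<exists>w\<in>F. card w \<le> k \<and> supp \<beta> \<subseteq> w \<and> supp b \<subseteq> w}"

definition D2 :: "real^'p \<Rightarrow> (real^'p) set" where
  "D2 \<beta> = {b. supp b \<subseteq> supp \<beta>}"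

text \<open>The supremum is taken in \<open>[0,\<infinity>]\<close>, so it is meaningful without a boundedness proof.
  \<open>R\<close> and \<open>Rn\<close> stand for the risk and for the empirical risk at a fixed outcome.\<close>

definition sup_dev :: "(real^'p \<Rightarrow> real) \<Rightarrow> (real^'p \<Rightarrow> real) \<Rightarrow> real^'p \<Rightarrow> (real^'p) set \<Rightarrow> (real^'p) set
    \<Rightarrow> ennreal" where
  "sup_dev R Rn \<beta> D B = (SUP b\<in>{b\<in>D. b - \<beta> \<in> B}. ennreal \<bar>excess R \<beta> b - excess Rn \<beta> b\<bar>)"

end

theory Submission
  imports Defs
begin

text \<open>
  Write \<open>f\<^sub>b(z)\<close> for the loss difference between \<open>b\<close> and \<open>\<beta>\<close> at an observation \<open>z\<close>, and \<open>m\<^sub>b\<close> for its mean.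
  For a finite set of parameters \<open>b\<close> and constants \<open>g\<^sub>b\<close>, splitting \<open>g + f - m\<close> into the halves \<open>g + 2f\<close>
  and \<open>g - 2m\<close> and applying Jensen to the second one gives
  \<open>E max (g + f - m) \<le> (E max (g + 2f) + E max (g - 2f)) / 2\<close>: one observation is symmetrized without
  a ghost sample. The Lipschitz condition then replaces \<open>f\<^sub>b\<close> by \<open>L\<close> times the linear form
  \<open>(b - \<beta>) \<bullet> x\<close> in the two-point average. Doing this for one observation after the other bounds the
  expected deviation by \<open>4 L / n\<close> times the expected supremum of \<open>(b - \<beta>) \<bullet> V\<close>, where \<open>V\<close> is a
  randomly signed sum of the predictors. The coordinates of \<open>V\<close> are subgaussian with parameter
  \<open>n s\<^sup>2\<close>, so the supremum is controlled by the maximum norm of \<open>V\<close> on an \<open>\<ell>\<^sub>1\<close> ball, and by the Euclidean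
  norm of its restriction to the support on an \<open>\<ell>\<^sub>2\<close> ball. The set for \<open>S\<^sub>1\<close> lies in the
  \<open>\<ell>\<^sub>1\<close> ball of radius \<open>r \<surd>k\<close>. A countable dense subset reduces the suprema to finite sets.
\<close>

section \<open>Maxima of finite families and product measures\<close>

lemma integrable_MAX:
  fixes f :: "'b \<Rightarrow> 'z \<Rightarrow> real"
  assumes "finite T" "T \<noteq> {}" "\<And>b. b \<in> T \<Longrightarrow> integrable M (f b)"
  shows "integrable M (\<lambda>x. MAX b\<in>T. f b x)"
  using assms
proof (induction T rule: finite_ne_induct)
  case (insert b T)
  then have "(\<lambda>x. MAX b\<in>insert b T. f b x) = (\<lambda>x. max (f b x) (MAX b\<in>T. f b x))"
    by (intro ext) (simp add: Max_insert)
  with insert show ?case by simp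
qed simp

lemma MAX_add_mono:
  fixes f g h :: "'b \<Rightarrow> real"
  assumes "finite T" "T \<noteq> {}" "\<And>b. b \<in> T \<Longrightarrow> f b \<le> g b + h b"
  shows "(MAX b\<in>T. f b) \<le> (MAX b\<in>T. g b) + (MAX b\<in>T. h b)"
  using assms by (auto simp: Max_le_iff intro!: order_trans[OF assms(3) add_mono] Max_ge)

lemma MAX_scale:
  fixes f :: "'b \<Rightarrow> real"
  assumes "finite T" "T \<noteq> {}" "c \<ge> 0"
  shows "(MAX b\<in>T. c * f b) = c * (MAX b\<in>T. f b)"
proof -
  have "mono ((*) c)" using assms by (auto simp: mono_def mult_left_mono)
  from mono_Max_commute[OF this, of "f ` T"] assms show ?thesis by (simp add: image_image)
qed

text \<open>The two-point form of the contraction principle. Only the maximizers \<open>b\<close>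
  and \<open>b'\<close> on the left matter: the left side is \<open>g b + g b'\<close> plus
  \<open>f b - f b'\<close>, and this difference is at most \<open>\<bar>u b - u b'\<bar>\<close>.
  Depending on the sign of \<open>u b - u b'\<close>, the right-hand maxima are tested at
  \<open>b\<close> and \<open>b'\<close> or the other way round.\<close>

lemma contraction_step:
  fixes f g u :: "'b \<Rightarrow> real"
  assumes T: "finite T" "T \<noteq> {}"
    and lip: "\<And>b b'. b \<in> T \<Longrightarrow> b' \<in> T \<Longrightarrow> \<bar>f b - f b'\<bar> \<le> \<bar>u b - u b'\<bar>"
  shows "(MAX b\<in>T. g b + f b) + (MAX b\<in>T. g b - f b) \<le> (MAX b\<in>T. g b + u b) + (MAX b\<in>T. g b - u b)"
proof -
  have "(MAX b\<in>T. g b + f b) \<in> (\<lambda>b. g b + f b) ` T" "(MAX b\<in>T. g b - f b) \<in> (\<lambda>b. g b - f b) ` T"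
    using T by (auto intro!: Max_in simp del: Max_in)
  then obtain b b' where b: "b \<in> T" "b' \<in> T"
    "(MAX b\<in>T. g b + f b) = g b + f b" "(MAX b\<in>T. g b - f b) = g b' - f b'" by auto
  have "g a + u a \<le> (MAX b\<in>T. g b + u b)" "g a - u a \<le> (MAX b\<in>T. g b - u b)" if "a \<in> T" for a
    using that T by (auto intro!: Max_ge)
  from this[OF b(1)] this[OF b(2)] lip[OF b(1,2)] b show ?thesis by (auto simp: abs_if split: if_splits)
qed

lemma integrable_PiM_component:
  fixes h :: "'z \<Rightarrow> real"
  assumes "\<And>i. i \<in> I \<Longrightarrow> prob_space (N i)" "i \<in> I" "integrable (N i) h"
  shows "integrable (PiM I N) (\<lambda>z. h (z i))"
  using assms(3) integrable_distr_eq[of "\<lambda>z. z i" "PiM I N" "N i" h] assms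
  by (simp add: distr_PiM_component)

lemma integrable_pair_fst:
  fixes h :: "'z \<Rightarrow> real"
  assumes "prob_space N" "integrable M h"
  shows "integrable (M \<Otimes>\<^sub>M N) (\<lambda>x. h (fst x))"
  using assms integrable_distr_eq[of fst "M \<Otimes>\<^sub>M N" M h] by (simp add: prob_space.distr_pair_fst)

lemma integrable_pair_snd:
  fixes h :: "'z \<Rightarrow> real"
  assumes "prob_space M" "prob_space N" "integrable N h"
  shows "integrable (M \<Otimes>\<^sub>M N) (\<lambda>x. h (snd x))"
proof -
  interpret M: prob_space M by fact
  interpret N: prob_space N by fact
  interpret NM: pair_prob_space N M ..
  show ?thesis
    using NM.integrable_product_swap[OF integrable_pair_fst[OF assms(1,3)]] by (simp add: case_prod_unfold)
qed

text \<open>Fubini is needed because the one-step hypothesis replaces the last coordinate, while the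
  induction hypothesis replaces all the others.\<close>
lemma MAX_integral_tensorize:
  fixes a :: "'b \<Rightarrow> 'z \<Rightarrow> real" and c :: "'b \<Rightarrow> 'w \<Rightarrow> real" and I :: "'i set"
  assumes \<mu>: "prob_space \<mu>" and \<nu>: "prob_space \<nu>" and T: "finite T" "T \<noteq> {}"
    and a: "\<And>b. b \<in> T \<Longrightarrow> integrable \<mu> (a b)" and c: "\<And>b. b \<in> T \<Longrightarrow> integrable \<nu> (c b)"
    and step: "\<And>g :: 'b \<Rightarrow> real. (\<integral>z. (MAX b\<in>T. g b + a b z) \<partial>\<mu>) \<le> (\<integral>w. (MAX b\<in>T. g b + c b w) \<partial>\<nu>)"
    and I: "finite I"
  shows "(\<integral>z. (MAX b\<in>T. g b + (\<Sum>i\<in>I. a b (z i))) \<partial>(PiM I (\<lambda>_. \<mu>)))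
    \<le> (\<integral>w. (MAX b\<in>T. g b + (\<Sum>i\<in>I. c b (w i))) \<partial>(PiM I (\<lambda>_. \<nu>)))"
  using I
proof (induction I arbitrary: g rule: finite_induct)
  case empty
  interpret A: prob_space "PiM {} (\<lambda>_. \<mu>)" by (intro prob_space_PiM \<mu>)
  interpret B: prob_space "PiM {} (\<lambda>_. \<nu>)" by (intro prob_space_PiM \<nu>)
  show ?case by (simp add: A.prob_space B.prob_space)
next
  case (insert i I)
  interpret m: prob_space \<mu> by fact
  interpret n: prob_space \<nu> by fact
  interpret A: prob_space "PiM I (\<lambda>_. \<mu>)" by (intro prob_space_PiM \<mu>)
  interpret B: prob_space "PiM I (\<lambda>_. \<nu>)" by (intro prob_space_PiM \<nu>)
  interpret mm: product_sigma_finite "\<lambda>_. \<mu>" ..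
  interpret nn: product_sigma_finite "\<lambda>_. \<nu>" ..
  interpret AM: pair_prob_space "PiM I (\<lambda>_. \<mu>)" \<mu> ..
  interpret AN: pair_prob_space "PiM I (\<lambda>_. \<mu>)" \<nu> ..
  interpret BN: pair_prob_space "PiM I (\<lambda>_. \<nu>)" \<nu> ..
  let ?A = "PiM I (\<lambda>_. \<mu>)" and ?B = "PiM I (\<lambda>_. \<nu>)"
  have compA: "integrable (PiM J (\<lambda>_. \<mu>)) (\<lambda>z. a b (z j))" if "b \<in> T" "j \<in> J" for b j and J :: "'i set"
    using that a \<mu> by (intro integrable_PiM_component) auto
  have compB: "integrable (PiM J (\<lambda>_. \<nu>)) (\<lambda>z. c b (z j))" if "b \<in> T" "j \<in> J" for b j and J :: "'i set"
    using that c \<nu> by (intro integrable_PiM_component) auto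
  have intA: "integrable (PiM J (\<lambda>_. \<mu>)) (\<lambda>z. g b + (\<Sum>j\<in>J. a b (z j)))"
    if "b \<in> T" for b g and J :: "'i set"
    using that compA prob_space_PiM[of J "\<lambda>_. \<mu>"] \<mu>
    by (auto intro!: Bochner_Integration.integrable_add Bochner_Integration.integrable_sum
        finite_measure.integrable_const intro: prob_space.finite_measure)
  have intB: "integrable (PiM J (\<lambda>_. \<nu>)) (\<lambda>z. g b + (\<Sum>j\<in>J. c b (z j)))"
    if "b \<in> T" for b g and J :: "'i set"
    using that compB prob_space_PiM[of J "\<lambda>_. \<nu>"] \<nu>
    by (auto intro!: Bochner_Integration.integrable_add Bochner_Integration.integrable_sum
        finite_measure.integrable_const intro: prob_space.finite_measure)
  have upd: "(\<Sum>j\<in>insert i I. f ((z(i := y)) j)) = (\<Sum>j\<in>I. f (z j)) + f y"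
    for f :: "'x \<Rightarrow> real" and z y using insert by (auto intro!: sum.cong)
  \<comment> \<open>The integrand passes through three mixtures: all coordinates from
    \<open>\<mu>\<close>, only the new one from \<open>\<nu>\<close>, all from \<open>\<nu>\<close>.
    Each needs joint integrability for the interchanges of integrals below.\<close>
  have pAM: "integrable (?A \<Otimes>\<^sub>M \<mu>) (\<lambda>x. MAX b\<in>T. (g b + (\<Sum>j\<in>I. a b (fst x j))) + a b (snd x))"
    by (intro integrable_MAX T Bochner_Integration.integrable_add integrable_pair_fst[OF \<mu>] integrable_pair_snd A.prob_space_axioms \<mu> a intA)
  have pAN: "integrable (?A \<Otimes>\<^sub>M \<nu>) (\<lambda>x. MAX b\<in>T. (g b + (\<Sum>j\<in>I. a b (fst x j))) + c b (snd x))"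
    by (intro integrable_MAX T Bochner_Integration.integrable_add integrable_pair_fst[OF \<nu>] integrable_pair_snd A.prob_space_axioms \<nu> c intA)
  have pBN: "integrable (?B \<Otimes>\<^sub>M \<nu>) (\<lambda>x. MAX b\<in>T. (g b + (\<Sum>j\<in>I. c b (fst x j))) + c b (snd x))"
    by (intro integrable_MAX T Bochner_Integration.integrable_add integrable_pair_fst[OF \<nu>] integrable_pair_snd B.prob_space_axioms \<nu> c intB)
  have "(\<integral>z. (MAX b\<in>T. g b + (\<Sum>j\<in>insert i I. a b (z j))) \<partial>(PiM (insert i I) (\<lambda>_. \<mu>)))
      = (\<integral>z. (\<integral>y. (MAX b\<in>T. (g b + (\<Sum>j\<in>I. a b (z j))) + a b y) \<partial>\<mu>) \<partial>?A)"
    by (subst mm.product_integral_insert[OF insert(1,2)])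
      (auto intro!: integrable_MAX T intA simp: upd add.assoc simp del: fun_upd_apply sum.insert)
  \<comment> \<open>For fixed \<open>z\<close> the sum over \<open>I\<close> is a constant for each
    \<open>b\<close> and is absorbed into \<open>g\<close>, so the one-step hypothesis
    applies.\<close>
  also have "\<dots> \<le> (\<integral>z. (\<integral>w. (MAX b\<in>T. (g b + (\<Sum>j\<in>I. a b (z j))) + c b w) \<partial>\<nu>) \<partial>?A)"
    using AM.integrable_fst'[OF pAM] AN.integrable_fst'[OF pAN] step
    by (intro integral_mono) auto
  also have "\<dots> = (\<integral>w. (\<integral>z. (MAX b\<in>T. (g b + (\<Sum>j\<in>I. a b (z j))) + c b w) \<partial>?A) \<partial>\<nu>)"
    using pAN by (intro AN.Fubini_integral[symmetric]) (simp add: case_prod_unfold)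
  also have "\<dots> \<le> (\<integral>w. (\<integral>z. (MAX b\<in>T. (g b + (\<Sum>j\<in>I. c b (z j))) + c b w) \<partial>?B) \<partial>\<nu>)"
  proof (intro integral_mono)
    show "integrable \<nu> (\<lambda>w. (\<integral>z. (MAX b\<in>T. (g b + (\<Sum>j\<in>I. a b (z j))) + c b w) \<partial>?A))"
      using AN.integrable_snd[of "\<lambda>z w. MAX b\<in>T. (g b + (\<Sum>j\<in>I. a b (z j))) + c b w"] pAN
      by (simp add: case_prod_unfold)
    show "integrable \<nu> (\<lambda>w. (\<integral>z. (MAX b\<in>T. (g b + (\<Sum>j\<in>I. c b (z j))) + c b w) \<partial>?B))"
      using BN.integrable_snd[of "\<lambda>z w. MAX b\<in>T. (g b + (\<Sum>j\<in>I. c b (z j))) + c b w"] pBN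
      by (simp add: case_prod_unfold)
    fix w
    show "(\<integral>z. (MAX b\<in>T. (g b + (\<Sum>j\<in>I. a b (z j))) + c b w) \<partial>?A)
      \<le> (\<integral>z. (MAX b\<in>T. (g b + (\<Sum>j\<in>I. c b (z j))) + c b w) \<partial>?B)"
      \<comment> \<open>Now \<open>w\<close> is fixed and \<open>c b w\<close> is absorbed into
        \<open>g\<close>; this is why the induction keeps \<open>g\<close> arbitrary.\<close>
      using insert.IH[of "\<lambda>b. g b + c b w"] by (simp add: ac_simps)
  qed
  also have "\<dots> = (\<integral>z. (\<integral>w. (MAX b\<in>T. (g b + (\<Sum>j\<in>I. c b (z j))) + c b w) \<partial>\<nu>) \<partial>?B)"
    using pBN by (intro BN.Fubini_integral) (simp add: case_prod_unfold)
  also have "\<dots> = (\<integral>z. (MAX b\<in>T. g b + (\<Sum>j\<in>insert i I. c b (z j))) \<partial>(PiM (insert i I) (\<lambda>_. \<nu>)))"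
    by (subst nn.product_integral_insert[OF insert(1,2)])
      (auto intro!: integrable_MAX T intB simp: upd add.assoc simp del: fun_upd_apply sum.insert)
  finally show ?case .
qed

section \<open>Subgaussian variables\<close>

text \<open>With \<open>a = \<bar>x\<bar> / 2\<close> the difference
  \<open>exp x + exp (- x) - 2\<close> is the square of \<open>exp a - exp (- a)\<close>, so it
  suffices that \<open>exp a - exp (- a) \<ge> 2 * a\<close>.\<close>

lemma exp_add_exp_minus_ge:
  fixes x :: real
  shows "2 + x\<^sup>2 \<le> exp x + exp (- x)"
proof -
  define a p where "a = \<bar>x\<bar> / 2" and "p = 1 + a + a\<^sup>2 / 2"
  have a: "a \<ge> 0" and p: "p \<ge> 1" by (auto simp: a_def p_def)
  have "p \<le> exp a" unfolding p_def using a by (rule exp_lower_Taylor_quadratic)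
  \<comment> \<open>The Taylor polynomial \<open>p\<close> satisfies
    \<open>p - 1 / p \<ge> 2 * a\<close>, and \<open>exp a - exp (- a)\<close> is at least
    \<open>p - 1 / p\<close>.\<close>
  have "p * (p - 2 * a) = 1 + a ^ 4 / 4"
    by (simp add: p_def field_simps power2_eq_square power4_eq_xxxx)
  then have "1 \<le> p * (p - 2 * a)" by simp
  then have "1 / p \<le> p - 2 * a" using p by (simp add: field_simps)
  moreover have "exp (- a) \<le> 1 / p"
    using \<open>p \<le> exp a\<close> p by (simp add: exp_minus field_simps)
  ultimately have "2 * a \<le> exp a - exp (- a)" using \<open>p \<le> exp a\<close> by linarith
  then have "(2 * a)\<^sup>2 \<le> (exp a - exp (- a))\<^sup>2" using a by (intro power_mono) auto
  also have "\<dots> = exp (a + a) + exp (- (a + a)) - 2"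
    by (simp add: power2_eq_square algebra_simps flip: exp_add)
  also have "a + a = \<bar>x\<bar>" by (simp add: a_def)
  finally show ?thesis by (cases "x \<ge> 0") (auto simp: a_def power_divide add.commute)
qed

text \<open>The definition speaks only of exponentials of \<open>Z\<close>; measurability of
  \<open>Z\<close> itself is recovered by taking the logarithm at \<open>t = 1\<close>.\<close>

lemma subgaussian_measurable:
  assumes "subgaussian N Z v"
  shows "Z \<in> borel_measurable N"
proof -
  have "(\<lambda>\<omega>. exp (1 * Z \<omega>)) \<in> borel_measurable N"
    using assms borel_measurable_integrable unfolding subgaussian_def by blast
  then have "(\<lambda>\<omega>. ln (exp (1 * Z \<omega>))) \<in> borel_measurable N" by measurable
  then show ?thesis by simp
qed

lemma subgaussian_mono:
  assumes "subgaussian N Z v" "v \<le> v'"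
  shows "subgaussian N Z v'"
proof -
  have "exp (t\<^sup>2 * v / 2) \<le> exp (t\<^sup>2 * v' / 2)" for t :: real
    using assms(2) by (simp add: mult_left_mono)
  then show ?thesis using assms(1) unfolding subgaussian_def by (meson order_trans)
qed

text \<open>Averaging the exponential moments at \<open>t\<close> and \<open>- t\<close> bounds the
  second moment by a quotient in \<open>t\<^sup>2\<close>, whose limit as \<open>t\<close> tends to
  0 is \<open>v\<close>.\<close>

lemma subgaussian_power2:
  assumes N: "prob_space N" and Z: "subgaussian N Z v"
  shows "integrable N (\<lambda>\<omega>. (Z \<omega>)\<^sup>2)" and "(\<integral>\<omega>. (Z \<omega>)\<^sup>2 \<partial>N) \<le> v"
proof -
  interpret prob_space N by fact
  note [measurable] = subgaussian_measurable[OF Z]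
  have e: "integrable N (\<lambda>\<omega>. exp (t * Z \<omega>))" "(\<integral>\<omega>. exp (t * Z \<omega>) \<partial>N) \<le> exp (t\<^sup>2 * v / 2)" for t
    using Z by (auto simp: subgaussian_def)
  have e': "integrable N (\<lambda>\<omega>. exp (- (t * Z \<omega>)))" "(\<integral>\<omega>. exp (- (t * Z \<omega>)) \<partial>N) \<le> exp (t\<^sup>2 * v / 2)" for t
    using e[of "- t"] by simp_all
  show int: "integrable N (\<lambda>\<omega>. (Z \<omega>)\<^sup>2)"
  proof (rule Bochner_Integration.integrable_bound)
    show "integrable N (\<lambda>\<omega>. exp (1 * Z \<omega>) + exp (- (1 * Z \<omega>)))"
      by (intro Bochner_Integration.integrable_add e e')
    show "AE \<omega> in N. norm ((Z \<omega>)\<^sup>2) \<le> norm (exp (1 * Z \<omega>) + exp (- (1 * Z \<omega>)))"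
    proof (intro AE_I2)
      fix \<omega>
      show "norm ((Z \<omega>)\<^sup>2) \<le> norm (exp (1 * Z \<omega>) + exp (- (1 * Z \<omega>)))"
        using exp_add_exp_minus_ge[of "Z \<omega>"] by simp
    qed
  qed measurable
  have bound: "(\<integral>\<omega>. (Z \<omega>)\<^sup>2 \<partial>N) \<le> (exp (h * v) - 1) / h" if "h > 0" for h
  proof -
    \<comment> \<open>Chosen so that the subgaussian exponent \<open>t\<^sup>2 * v / 2\<close>
      equals \<open>h * v\<close>.\<close>
    define t where "t = sqrt (2 * h)"
    have t: "t\<^sup>2 = 2 * h" using that by (simp add: t_def)
    have "2 + t\<^sup>2 * (\<integral>\<omega>. (Z \<omega>)\<^sup>2 \<partial>N) = (\<integral>\<omega>. 2 + t\<^sup>2 * (Z \<omega>)\<^sup>2 \<partial>N)"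
      using int by (simp add: prob_space)
    also have "\<dots> \<le> (\<integral>\<omega>. exp (t * Z \<omega>) + exp (- (t * Z \<omega>)) \<partial>N)"
    proof (rule integral_mono)
      fix \<omega>
      show "2 + t\<^sup>2 * (Z \<omega>)\<^sup>2 \<le> exp (t * Z \<omega>) + exp (- (t * Z \<omega>))"
        using exp_add_exp_minus_ge[of "t * Z \<omega>"] by (simp add: power_mult_distrib)
    qed (use int e(1) e'(1) in auto)
    also have "\<dots> \<le> 2 * exp (h * v)"
      using e[of t] e'[of t] t by simp
    finally show ?thesis using that by (simp add: t field_simps)
  qed
  \<comment> \<open>The bound is the difference quotient of \<open>exp (h * v)\<close> at 0, so its
    limit is the derivative there.\<close>
  have "((\<lambda>h. (exp ((0 + h) * v) - exp (0 * v)) / h) \<longlongrightarrow> v) (at 0)"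
  proof -
    have "((\<lambda>h. exp (h * v)) has_real_derivative v) (at 0)"
      by (auto intro!: derivative_eq_intros)
    then show ?thesis unfolding DERIV_def by simp
  qed
  then have "((\<lambda>h. (exp (h * v) - 1) / h) \<longlongrightarrow> v) (at_right 0)"
    by (simp add: filterlim_at_split)
  then show "(\<integral>\<omega>. (Z \<omega>)\<^sup>2 \<partial>N) \<le> v"
    by (rule tendsto_lowerbound) (auto intro!: bound eventually_at_rightI[of 0 1])
qed

lemma subgaussian_integrable:
  assumes N: "prob_space N" and Z: "subgaussian N Z v"
  shows "integrable N Z"
  using finite_measure.square_integrable_imp_integrable[of N Z] subgaussian_power2(1)[OF N Z]
    subgaussian_measurable[OF Z] prob_space.finite_measure[OF N] by simp

text \<open>The quantity \<open>P\<close> arises as an upper bound for half of \<open>ln (2 * card J)\<close>; the infimum over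
  \<open>\<lambda>\<close> is not attained if \<open>v = 0\<close>.\<close>
lemma optimize_exponential_bound:
  fixes A P v :: real
  assumes "P > 0" "v \<ge> 0" "\<And>l. l > 0 \<Longrightarrow> A \<le> 2 * P / l + l * v / 2"
  shows "A \<le> 2 * sqrt (v * P)"
proof (cases "v = 0")
  case True
  have "A \<le> 0"
  proof (rule ccontr)
    assume "\<not> A \<le> 0"
    \<comment> \<open>With \<open>v = 0\<close> this choice of \<open>l\<close> makes the right-hand
      side \<open>A / 2\<close>.\<close>
    then show False using assms(3)[of "4 * P / A"] assms(1) True by (simp add: field_simps)
  qed
  then show ?thesis using True by simp
next
  case False
  then have v: "v > 0" using assms by simp
  define a b where "a = sqrt v" and "b = sqrt P"
  have ab: "a > 0" "b > 0" "v = a\<^sup>2" "P = b\<^sup>2" using v assms by (auto simp: a_def b_def)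
  \<comment> \<open>The point \<open>2 * b / a\<close> minimizes the right-hand side: both summands
    equal \<open>a * b\<close> there.\<close>
  have "A \<le> 2 * P / (2 * b / a) + (2 * b / a) * v / 2" using ab by (intro assms(3)) simp
  also have "\<dots> = 2 * (a * b)" using ab by (simp add: field_simps power2_eq_square)
  finally show ?thesis by (simp add: a_def b_def real_sqrt_mult)
qed

text \<open>The exponential of \<open>l\<close> times the maximum is at most the sum of
  \<open>2 * card J\<close> exponentials, one for each index and sign. Taking logarithms of the
  means and optimizing over \<open>l\<close> gives the bound.\<close>

lemma subgaussian_MAX_abs:
  fixes Z :: "'j \<Rightarrow> 'z \<Rightarrow> real"
  assumes N: "prob_space N" and J: "finite J" "J \<noteq> {}" and v: "v \<ge> 0"
    and Z: "\<And>j. j \<in> J \<Longrightarrow> subgaussian N (Z j) v"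
  shows "integrable N (\<lambda>\<omega>. MAX j\<in>J. \<bar>Z j \<omega>\<bar>)"
    and "(\<integral>\<omega>. (MAX j\<in>J. \<bar>Z j \<omega>\<bar>) \<partial>N) \<le> 2 * sqrt (v * ln (real (max (card J) 2)))"
proof -
  interpret prob_space N by fact
  show int: "integrable N (\<lambda>\<omega>. MAX j\<in>J. \<bar>Z j \<omega>\<bar>)"
    using J Z subgaussian_integrable[OF N] by (intro integrable_MAX) auto
  define m where "m \<omega> = (MAX j\<in>J. \<bar>Z j \<omega>\<bar>)" for \<omega>
  let ?P = "ln (real (max (card J) 2))"
  have card: "card J > 0" using J by (simp add: card_gt_0_iff)
  \<comment> \<open>Since \<open>2 * card J\<close> is at most the square of
    \<open>max (card J) 2\<close>, the two signs are paid for by a factor 2 in front of the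
    logarithm. The maximum with 2 also keeps that logarithm positive when
    \<open>card J = 1\<close>.\<close>
  have P: "ln (2 * real (card J)) \<le> 2 * ?P"
  proof -
    have "2 * real (card J) \<le> (real (max (card J) 2))\<^sup>2"
      unfolding power2_eq_square by (intro mult_mono) auto
    then have "ln (2 * real (card J)) \<le> ln ((real (max (card J) 2))\<^sup>2)"
      using card by (intro ln_mono) auto
    then show ?thesis by (simp add: ln_realpow)
  qed
  have "(\<integral>\<omega>. m \<omega> \<partial>N) \<le> 2 * ?P / l + l * v / 2" if l: "l > 0" for l
  proof -
    define c where "c = 2 * real (card J) * exp (l\<^sup>2 * v / 2)"
    have c: "c > 0" using card by (simp add: c_def)
    have e: "integrable N (\<lambda>\<omega>. exp (t * Z j \<omega>))" "(\<integral>\<omega>. exp (t * Z j \<omega>) \<partial>N) \<le> exp (t\<^sup>2 * v / 2)"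
      if "j \<in> J" for t j using Z[OF that] by (auto simp: subgaussian_def)
    have e': "integrable N (\<lambda>\<omega>. exp (- (l * Z j \<omega>)))" "(\<integral>\<omega>. exp (- (l * Z j \<omega>)) \<partial>N) \<le> exp (l\<^sup>2 * v / 2)"
      if "j \<in> J" for j using e[OF that, of "- l"] by simp_all
    define G where "G \<omega> = (\<Sum>j\<in>J. exp (l * Z j \<omega>) + exp (- (l * Z j \<omega>)))" for \<omega>
    have G: "integrable N G" unfolding G_def
      by (intro Bochner_Integration.integrable_sum Bochner_Integration.integrable_add e e')
    have "(\<integral>\<omega>. G \<omega> \<partial>N) = (\<Sum>j\<in>J. (\<integral>\<omega>. exp (l * Z j \<omega>) \<partial>N) + (\<integral>\<omega>. exp (- (l * Z j \<omega>)) \<partial>N))"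
      unfolding G_def using e e' by (subst Bochner_Integration.integral_sum) auto
    also have "\<dots> \<le> (\<Sum>j\<in>J. 2 * exp (l\<^sup>2 * v / 2))"
      using e(2)[of _ l] e'(2) by (intro sum_mono) (smt (verit))
    also have "\<dots> = c" by (simp add: c_def)
    finally have Gc: "(\<integral>\<omega>. G \<omega> \<partial>N) \<le> c" .
    \<comment> \<open>The tangent line of \<open>ln\<close> at \<open>c\<close> replaces Jensen's
      inequality: as \<open>G\<close> has mean at most \<open>c\<close>, the terms
      \<open>G \<omega> / c - 1\<close> integrate to at most 0.\<close>
    have point: "l * m \<omega> \<le> ln c + G \<omega> / c - 1" for \<omega>
    proof -
      have "m \<omega> \<in> (\<lambda>j. \<bar>Z j \<omega>\<bar>) ` J" unfolding m_def using J by (intro Max_in) auto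
      then obtain j where j: "j \<in> J" "m \<omega> = \<bar>Z j \<omega>\<bar>" by auto
      have "exp (l * m \<omega>) \<le> exp (l * Z j \<omega>) + exp (- (l * Z j \<omega>))"
        unfolding j(2) by (cases "Z j \<omega> \<ge> 0") (auto simp: add_increasing add_increasing2)
      also have "\<dots> \<le> G \<omega>" unfolding G_def using J j(1) by (intro member_le_sum) (auto intro: add_nonneg_nonneg)
      finally have le: "exp (l * m \<omega>) / c \<le> G \<omega> / c" using c by (intro divide_right_mono) auto
      have "ln (exp (l * m \<omega>) / c) \<le> exp (l * m \<omega>) / c - 1" using c by (intro ln_le_minus_one) auto
      moreover have "ln (exp (l * m \<omega>) / c) = l * m \<omega> - ln c" using c by (simp add: ln_div)
      ultimately show ?thesis using le by linarith
    qed
    have "l * (\<integral>\<omega>. m \<omega> \<partial>N) = (\<integral>\<omega>. l * m \<omega> \<partial>N)" by simp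
    also have "\<dots> \<le> (\<integral>\<omega>. ln c + G \<omega> / c - 1 \<partial>N)"
      using point G int by (intro integral_mono) (auto simp: m_def)
    also have "\<dots> = ln c + (\<integral>\<omega>. G \<omega> \<partial>N) / c - 1" using G by (simp add: prob_space)
    also have "\<dots> \<le> ln c" using Gc c by simp
    also have "ln c = ln (2 * real (card J)) + l\<^sup>2 * v / 2"
      unfolding c_def using card by (subst ln_mult) auto
    also have "\<dots> \<le> 2 * ?P + l\<^sup>2 * v / 2" using P by simp
    finally show ?thesis using l by (simp add: field_simps power2_eq_square)
  qed
  then show "(\<integral>\<omega>. (MAX j\<in>J. \<bar>Z j \<omega>\<bar>) \<partial>N) \<le> 2 * sqrt (v * ?P)"
    using optimize_exponential_bound[of ?P v "\<integral>\<omega>. m \<omega> \<partial>N"] v by (simp add: m_def)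
qed

text \<open>The square of the mean norm is at most the mean squared norm, since a variance is
  nonnegative, and each coordinate contributes at most \<open>v\<close> to the latter. There is
  neither a logarithm nor a factor 2 here, which explains the smaller constant for
  \<open>S2\<close>.\<close>

lemma subgaussian_L2:
  fixes Z :: "'j \<Rightarrow> 'z \<Rightarrow> real"
  assumes N: "prob_space N" and J: "finite J"
    and Z: "\<And>j. j \<in> J \<Longrightarrow> subgaussian N (Z j) v"
  shows "integrable N (\<lambda>\<omega>. L2_set (\<lambda>j. Z j \<omega>) J)"
    and "(\<integral>\<omega>. L2_set (\<lambda>j. Z j \<omega>) J \<partial>N) \<le> sqrt (real (card J) * v)"
proof -
  interpret prob_space N by fact
  have sq: "(L2_set (\<lambda>j. Z j \<omega>) J)\<^sup>2 = (\<Sum>j\<in>J. (Z j \<omega>)\<^sup>2)" for \<omega>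
    unfolding L2_set_def by (simp add: sum_nonneg)
  have int2: "integrable N (\<lambda>\<omega>. (L2_set (\<lambda>j. Z j \<omega>) J)\<^sup>2)"
    unfolding sq using subgaussian_power2[OF N Z] by (intro Bochner_Integration.integrable_sum) auto
  have "(\<lambda>\<omega>. sqrt ((L2_set (\<lambda>j. Z j \<omega>) J)\<^sup>2)) \<in> borel_measurable N"
    using borel_measurable_integrable[OF int2] by (rule measurable_compose) simp
  then have meas: "(\<lambda>\<omega>. L2_set (\<lambda>j. Z j \<omega>) J) \<in> borel_measurable N"
    by simp
  show int: "integrable N (\<lambda>\<omega>. L2_set (\<lambda>j. Z j \<omega>) J)"
    using meas int2 by (rule square_integrable_imp_integrable)
  have "(\<integral>\<omega>. L2_set (\<lambda>j. Z j \<omega>) J \<partial>N)\<^sup>2 \<le> (\<integral>\<omega>. (L2_set (\<lambda>j. Z j \<omega>) J)\<^sup>2 \<partial>N)"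
    using variance_positive[of "\<lambda>\<omega>. L2_set (\<lambda>j. Z j \<omega>) J"] variance_eq[OF int int2] by simp
  also have "\<dots> = (\<Sum>j\<in>J. (\<integral>\<omega>. (Z j \<omega>)\<^sup>2 \<partial>N))"
    unfolding sq using subgaussian_power2[OF N Z] by (intro Bochner_Integration.integral_sum) auto
  also have "\<dots> \<le> (\<Sum>j\<in>J. v)" using subgaussian_power2[OF N Z] by (intro sum_mono) auto
  finally show "(\<integral>\<omega>. L2_set (\<lambda>j. Z j \<omega>) J \<partial>N) \<le> sqrt (real (card J) * v)"
    by (intro real_le_rsqrt) simp
qed

text \<open>Under the product measure the exponential moment of the sum factorizes, so the variance
  parameters add up.\<close>

lemma subgaussian_sum_PiM:
  assumes N: "prob_space N" and Z: "subgaussian N Z v" and I: "finite I"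
  shows "subgaussian (PiM I (\<lambda>_. N)) (\<lambda>w. \<Sum>i\<in>I. Z (w i)) (real (card I) * v)"
  unfolding subgaussian_def
proof
  fix t :: real
  interpret prob_space N by fact
  interpret product_sigma_finite "\<lambda>_. N" ..
  have e: "integrable N (\<lambda>\<omega>. exp (t * Z \<omega>))" "(\<integral>\<omega>. exp (t * Z \<omega>) \<partial>N) \<le> exp (t\<^sup>2 * v / 2)"
    using Z by (auto simp: subgaussian_def)
  have eq: "exp (t * (\<Sum>i\<in>I. Z (w i))) = (\<Prod>i\<in>I. exp (t * Z (w i)))" for w :: "_ \<Rightarrow> _"
    using I by (simp add: sum_distrib_left exp_sum)
  have "(\<Prod>i\<in>I. (\<integral>\<omega>. exp (t * Z \<omega>) \<partial>N)) \<le> (\<Prod>i\<in>I. exp (t\<^sup>2 * v / 2))"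
    using e(2) by (intro prod_mono) auto
  also have "\<dots> = exp (t\<^sup>2 * (real (card I) * v) / 2)"
    by (simp add: flip: exp_of_nat_mult)
  finally show "integrable (PiM I (\<lambda>_. N)) (\<lambda>w. exp (t * (\<Sum>i\<in>I. Z (w i)))) \<and>
    (\<integral>w. exp (t * (\<Sum>i\<in>I. Z (w i))) \<partial>PiM I (\<lambda>_. N)) \<le> exp (t\<^sup>2 * (real (card I) * v) / 2)"
    unfolding eq using product_integrable_prod[OF I, of "\<lambda>_ \<omega>. exp (t * Z \<omega>)"]
      product_integral_prod[OF I, of "\<lambda>_ \<omega>. exp (t * Z \<omega>)"] e by simp
qed

section \<open>Symmetrization and contraction\<close>

text \<open>A fair random sign. The underlying space is all of the reals, so the value is 1 or -1
  only almost surely.\<close>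

abbreviation rademacher :: "real measure" where
  "rademacher \<equiv> measure_pmf (pmf_of_set {-1, 1})"

lemma integral_rademacher: "(\<integral>e. h e \<partial>rademacher) = (h (- 1) + h 1) / 2"
  for h :: "real \<Rightarrow> real"
  by (simp add: integral_pmf_of_set)

lemma AE_pair_rademacher:
  assumes "prob_space \<mu>"
  shows "AE w in \<mu> \<Otimes>\<^sub>M rademacher. snd w = 1 \<or> snd w = - 1"
proof -
  interpret \<mu>: prob_space \<mu> by fact
  interpret pair_prob_space \<mu> rademacher ..
  have "{w \<in> space (\<mu> \<Otimes>\<^sub>M rademacher). snd w \<in> {1, - 1}} \<in> sets (\<mu> \<Otimes>\<^sub>M rademacher)"
    by (rule measurable_sets_Collect[OF measurable_snd]) simp
  then show ?thesis
    by (intro AE_pair_measure) (auto simp: AE_measure_pmf_iff)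
qed

lemma integrable_signed:
  fixes h :: "'z \<Rightarrow> real"
  assumes "prob_space \<mu>" "integrable \<mu> h"
  shows "integrable (\<mu> \<Otimes>\<^sub>M rademacher) (\<lambda>w. snd w * h (fst w))"
proof (rule Bochner_Integration.integrable_bound)
  show "integrable (\<mu> \<Otimes>\<^sub>M rademacher) (\<lambda>w. h (fst w))"
    using assms by (intro integrable_pair_fst measure_pmf.prob_space_axioms)
  have [measurable]: "h \<in> borel_measurable \<mu>" using assms by simp
  have [measurable]: "snd \<in> borel_measurable (\<mu> \<Otimes>\<^sub>M rademacher)"
    by (rule measurable_compose[OF measurable_snd]) simp
  show "(\<lambda>w. snd w * h (fst w)) \<in> borel_measurable (\<mu> \<Otimes>\<^sub>M rademacher)" by measurable
  show "AE w in \<mu> \<Otimes>\<^sub>M rademacher. norm (snd w * h (fst w)) \<le> norm (h (fst w))"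
    using AE_pair_rademacher[OF assms(1)] by eventually_elim auto
qed

lemma integral_pair_rademacher:
  fixes h :: "'z \<times> real \<Rightarrow> real"
  assumes "prob_space \<mu>" "integrable (\<mu> \<Otimes>\<^sub>M rademacher) h"
  shows "(\<integral>w. h w \<partial>(\<mu> \<Otimes>\<^sub>M rademacher)) = (\<integral>z. (h (z, - 1) + h (z, 1)) / 2 \<partial>\<mu>)"
proof -
  interpret \<mu>: prob_space \<mu> by fact
  interpret pair_prob_space \<mu> rademacher ..
  show ?thesis using integral_fst'[OF assms(2)] by (simp only: integral_rademacher)
qed

text \<open>Integrating out the sign averages the exponential moments at \<open>t\<close> and
  \<open>- t\<close>; the bound depends on \<open>t\<^sup>2\<close> only.\<close>

lemma subgaussian_signed:
  assumes \<mu>: "prob_space \<mu>" and Z: "subgaussian \<mu> Z v"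
  shows "subgaussian (\<mu> \<Otimes>\<^sub>M rademacher) (\<lambda>w. snd w * Z (fst w)) v"
  unfolding subgaussian_def
proof
  fix t :: real
  have [measurable]: "Z \<in> borel_measurable \<mu>" using Z by (rule subgaussian_measurable)
  have [measurable]: "snd \<in> borel_measurable (\<mu> \<Otimes>\<^sub>M rademacher)"
    by (rule measurable_compose[OF measurable_snd]) simp
  have e: "integrable \<mu> (\<lambda>\<omega>. exp (t * Z \<omega>))" "(\<integral>\<omega>. exp (t * Z \<omega>) \<partial>\<mu>) \<le> exp (t\<^sup>2 * v / 2)" for t
    using Z by (auto simp: subgaussian_def)
  have e': "integrable \<mu> (\<lambda>\<omega>. exp (- (t * Z \<omega>)))" "(\<integral>\<omega>. exp (- (t * Z \<omega>)) \<partial>\<mu>) \<le> exp (t\<^sup>2 * v / 2)"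
    using e[of "- t"] by simp_all
  have int: "integrable (\<mu> \<Otimes>\<^sub>M rademacher) (\<lambda>w. exp (t * (snd w * Z (fst w))))"
  proof (rule Bochner_Integration.integrable_bound)
    show "integrable (\<mu> \<Otimes>\<^sub>M rademacher) (\<lambda>w. exp (t * Z (fst w)) + exp (- (t * Z (fst w))))"
      using e(1)[of t] e'(1)
      by (intro Bochner_Integration.integrable_add integrable_pair_fst measure_pmf.prob_space_axioms
          integrable_pair_fst[where h = "\<lambda>z. exp (t * Z z)"] integrable_pair_fst[where h = "\<lambda>z. exp (- (t * Z z))"])
    show "AE w in \<mu> \<Otimes>\<^sub>M rademacher. norm (exp (t * (snd w * Z (fst w))))
        \<le> norm (exp (t * Z (fst w)) + exp (- (t * Z (fst w))))"
      using AE_pair_rademacher[OF \<mu>] by eventually_elim auto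
  qed measurable
  show "integrable (\<mu> \<Otimes>\<^sub>M rademacher) (\<lambda>w. exp (t * (snd w * Z (fst w)))) \<and>
    (\<integral>w. exp (t * (snd w * Z (fst w))) \<partial>(\<mu> \<Otimes>\<^sub>M rademacher)) \<le> exp (t\<^sup>2 * v / 2)"
    using int e[of t] e' by (simp add: integral_pair_rademacher[OF \<mu> int])
qed

text \<open>The shifts \<open>g\<close> stand for the contribution of the other observations, so
  this has the shape of the one-step hypothesis of \<open>MAX_integral_tensorize\<close>. The factor
  2 is the price of splitting the centred term into two halves.\<close>

lemma symmetrization_step:
  fixes f u :: "'b \<Rightarrow> 'z \<Rightarrow> real" and g :: "'b \<Rightarrow> real"
  assumes \<mu>: "prob_space \<mu>" and T: "finite T" "T \<noteq> {}" and L: "L \<ge> 0"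
    and f: "\<And>b. b \<in> T \<Longrightarrow> integrable \<mu> (f b)" and u: "\<And>b. b \<in> T \<Longrightarrow> integrable \<mu> (u b)"
    and lip: "\<And>z b b'. z \<in> space \<mu> \<Longrightarrow> b \<in> T \<Longrightarrow> b' \<in> T \<Longrightarrow> \<bar>f b z - f b' z\<bar> \<le> L * \<bar>u b z - u b' z\<bar>"
  shows "(\<integral>z. (MAX b\<in>T. g b + (f b z - (\<integral>z. f b z \<partial>\<mu>))) \<partial>\<mu>)
    \<le> (\<integral>w. (MAX b\<in>T. g b + 2 * L * (snd w * u b (fst w))) \<partial>(\<mu> \<Otimes>\<^sub>M rademacher))"
proof -
  interpret prob_space \<mu> by fact
  let ?m = "\<lambda>b. \<integral>z. f b z \<partial>\<mu>"
  let ?F = "\<lambda>z. MAX b\<in>T. g b + 2 * f b z" and ?F' = "\<lambda>z. MAX b\<in>T. g b - 2 * f b z"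
  let ?U = "\<lambda>z. MAX b\<in>T. g b + 2 * L * u b z" and ?U' = "\<lambda>z. MAX b\<in>T. g b - 2 * L * u b z"
  have intF: "integrable \<mu> ?F" "integrable \<mu> ?F'" "integrable \<mu> ?U" "integrable \<mu> ?U'"
    using f u by (auto intro!: integrable_MAX T)
  \<comment> \<open>Jensen's inequality for the maximum: each \<open>g b - 2 * ?m b\<close> is the
    mean of a function lying below \<open>?F'\<close>.\<close>
  have m: "(MAX b\<in>T. g b - 2 * ?m b) \<le> (\<integral>z. ?F' z \<partial>\<mu>)"
  proof -
    have "g b - 2 * ?m b \<le> (\<integral>z. ?F' z \<partial>\<mu>)" if "b \<in> T" for b
    proof -
      have "g b - 2 * ?m b = (\<integral>z. g b - 2 * f b z \<partial>\<mu>)" using f that by (simp add: prob_space)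
      also have "\<dots> \<le> (\<integral>z. ?F' z \<partial>\<mu>)"
        using f that intF T by (intro integral_mono) (auto intro!: Max_ge)
      finally show ?thesis .
    qed
    then show ?thesis using T by (auto simp: Max_le_iff)
  qed
  have split: "(MAX b\<in>T. g b + (f b z - ?m b)) \<le> (?F z + (MAX b\<in>T. g b - 2 * ?m b)) / 2" for z
  proof -
    have "(MAX b\<in>T. g b + (f b z - ?m b)) \<le> (MAX b\<in>T. 1/2 * (g b + 2 * f b z)) + (MAX b\<in>T. 1/2 * (g b - 2 * ?m b))"
      using T by (intro MAX_add_mono) (auto simp: field_simps)
    also have "\<dots> = 1/2 * ?F z + 1/2 * (MAX b\<in>T. g b - 2 * ?m b)"
      using T by (intro arg_cong2[where f = "(+)"] MAX_scale) auto
    finally show ?thesis by simp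
  qed
  have "(\<integral>z. (MAX b\<in>T. g b + (f b z - ?m b)) \<partial>\<mu>) \<le> (\<integral>z. (?F z + (MAX b\<in>T. g b - 2 * ?m b)) / 2 \<partial>\<mu>)"
    using split intF f by (intro integral_mono) (auto intro!: integrable_MAX T)
  also have "\<dots> \<le> ((\<integral>z. ?F z \<partial>\<mu>) + (\<integral>z. ?F' z \<partial>\<mu>)) / 2"
  proof -
    have "(\<integral>z. (?F z + (MAX b\<in>T. g b - 2 * ?m b)) / 2 \<partial>\<mu>) = ((\<integral>z. ?F z \<partial>\<mu>) + (MAX b\<in>T. g b - 2 * ?m b)) / 2"
      by (simp only: integral_divide_zero Bochner_Integration.integral_add[OF intF(1) integrable_const]
          lebesgue_integral_const prob_space scaleR_one)
    with m show ?thesis by simp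
  qed
  also have "\<dots> = (\<integral>z. (?F z + ?F' z) / 2 \<partial>\<mu>)"
    by (simp only: integral_divide_zero Bochner_Integration.integral_add[OF intF(1,2)])
  also have "\<dots> \<le> (\<integral>z. (?U' z + ?U z) / 2 \<partial>\<mu>)"
  proof (rule integral_mono)
    fix z assume z: "z \<in> space \<mu>"
    \<comment> \<open>For fixed \<open>z\<close> the functions \<open>?F\<close> and
      \<open>?F'\<close> are the two signs of \<open>2 * f\<close>, so the two-point comparison
      replaces it by \<open>2 * L * u\<close>.\<close>
    have "?F z + ?F' z \<le> ?U z + ?U' z"
    proof (rule contraction_step[OF T])
      fix b b' assume "b \<in> T" "b' \<in> T"
      note le = lip[OF z this]
      have "\<bar>2 * f b z - 2 * f b' z\<bar> = 2 * \<bar>f b z - f b' z\<bar>" by (auto simp: abs_if)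
      also have "\<dots> \<le> \<bar>2 * L\<bar> * \<bar>u b z - u b' z\<bar>" using le L by simp
      also have "\<dots> = \<bar>2 * L * u b z - 2 * L * u b' z\<bar>"
        by (simp only: right_diff_distrib flip: abs_mult)
      finally show "\<bar>2 * f b z - 2 * f b' z\<bar> \<le> \<bar>2 * L * u b z - 2 * L * u b' z\<bar>" .
    qed
    then show "(?F z + ?F' z) / 2 \<le> (?U' z + ?U z) / 2" by simp
  qed (use intF in auto)
  \<comment> \<open>The average over the two signs is the integral against the random sign.\<close>
  also have "\<dots> = (\<integral>w. (MAX b\<in>T. g b + 2 * L * (snd w * u b (fst w))) \<partial>(\<mu> \<Otimes>\<^sub>M rademacher))"
  proof (subst integral_pair_rademacher[OF \<mu>])
    interpret pair_prob_space \<mu> rademacher ..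
    show "integrable (\<mu> \<Otimes>\<^sub>M rademacher) (\<lambda>w. MAX b\<in>T. g b + 2 * L * (snd w * u b (fst w)))"
      using integrable_signed[OF \<mu> u] by (intro integrable_MAX T) auto
  qed simp
  finally show ?thesis .
qed

lemma symmetrization_contraction:
  fixes f u :: "'b \<Rightarrow> 'z \<Rightarrow> real" and I :: "'i set"
  assumes \<mu>: "prob_space \<mu>" and T: "finite T" "T \<noteq> {}" and L: "L \<ge> 0" and I: "finite I"
    and f: "\<And>b. b \<in> T \<Longrightarrow> integrable \<mu> (f b)" and u: "\<And>b. b \<in> T \<Longrightarrow> integrable \<mu> (u b)"
    and lip: "\<And>z b b'. z \<in> space \<mu> \<Longrightarrow> b \<in> T \<Longrightarrow> b' \<in> T \<Longrightarrow> \<bar>f b z - f b' z\<bar> \<le> L * \<bar>u b z - u b' z\<bar>"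
  shows "(\<integral>z. (MAX b\<in>T. \<Sum>i\<in>I. f b (z i) - (\<integral>z. f b z \<partial>\<mu>)) \<partial>(PiM I (\<lambda>_. \<mu>)))
    \<le> (\<integral>w. (MAX b\<in>T. \<Sum>i\<in>I. 2 * L * (snd (w i) * u b (fst (w i)))) \<partial>(PiM I (\<lambda>_. \<mu> \<Otimes>\<^sub>M rademacher)))"
proof -
  interpret prob_space \<mu> by fact
  \<comment> \<open>The leading 0 is the initial shift \<open>g\<close> of the tensorized
    inequality.\<close>
  have "(\<integral>z. (MAX b\<in>T. 0 + (\<Sum>i\<in>I. f b (z i) - (\<integral>z. f b z \<partial>\<mu>))) \<partial>(PiM I (\<lambda>_. \<mu>)))
    \<le> (\<integral>w. (MAX b\<in>T. 0 + (\<Sum>i\<in>I. 2 * L * (snd (w i) * u b (fst (w i))))) \<partial>(PiM I (\<lambda>_. \<mu> \<Otimes>\<^sub>M rademacher)))"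
    using f integrable_signed[OF \<mu> u] assms
    by (intro MAX_integral_tensorize[where a = "\<lambda>b z. f b z - (\<integral>z. f b z \<partial>\<mu>)" and c = "\<lambda>b w. 2 * L * (snd w * u b (fst w))"]
        symmetrization_step prob_space_pair measure_pmf.prob_space_axioms) auto
  then show ?thesis by simp
qed

text \<open>A member \<open>b\<^sub>0\<close> with \<open>f b\<^sub>0 = 0\<close> makes both one-sided maxima nonnegative, so the maximum of the
  absolute values is at most their sum; this costs the second factor 2.\<close>
lemma expected_abs_deviation_le:
  fixes f :: "'b \<Rightarrow> 'z \<Rightarrow> real" and x :: "'z \<Rightarrow> 'v::{euclidean_space}" and d :: "'b \<Rightarrow> 'v"
    and I :: "'i set" and N :: "'v \<Rightarrow> real"
  assumes \<mu>: "prob_space \<mu>" and T: "finite T" and L: "L \<ge> 0" and I: "finite I"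
    and f: "\<And>b. b \<in> T \<Longrightarrow> integrable \<mu> (f b)" and x: "integrable \<mu> x"
    and lip: "\<And>z b b'. z \<in> space \<mu> \<Longrightarrow> b \<in> T \<Longrightarrow> b' \<in> T \<Longrightarrow> \<bar>f b z - f b' z\<bar> \<le> L * \<bar>d b \<bullet> x z - d b' \<bullet> x z\<bar>"
    and b0: "b0 \<in> T" "\<And>z. f b0 z = 0"
    and N: "\<And>b v. b \<in> T \<Longrightarrow> d b \<bullet> v \<le> N v"
    and int_N: "integrable (PiM I (\<lambda>_. \<mu> \<Otimes>\<^sub>M rademacher)) (\<lambda>w. N (\<Sum>i\<in>I. snd (w i) *\<^sub>R x (fst (w i))))"
  shows "(\<integral>z. (MAX b\<in>T. \<bar>\<Sum>i\<in>I. f b (z i) - (\<integral>z. f b z \<partial>\<mu>)\<bar>) \<partial>(PiM I (\<lambda>_. \<mu>)))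
    \<le> 4 * L * (\<integral>w. N (\<Sum>i\<in>I. snd (w i) *\<^sub>R x (fst (w i))) \<partial>(PiM I (\<lambda>_. \<mu> \<Otimes>\<^sub>M rademacher)))"
proof -
  interpret prob_space \<mu> by fact
  interpret P: prob_space "PiM I (\<lambda>_. \<mu>)" by (intro prob_space_PiM \<mu>)
  let ?P = "PiM I (\<lambda>_. \<mu>)" and ?Q = "PiM I (\<lambda>_. \<mu> \<Otimes>\<^sub>M rademacher)"
  let ?V = "\<lambda>w. \<Sum>i\<in>I. snd (w i) *\<^sub>R x (fst (w i))"
  have T': "T \<noteq> {}" using b0 by auto
  have u: "integrable \<mu> (\<lambda>z. d b \<bullet> x z)" for b using x by simp
  have Q: "prob_space (\<mu> \<Otimes>\<^sub>M rademacher)"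
    by (intro prob_space_pair \<mu> measure_pmf.prob_space_axioms)
  \<comment> \<open>After contraction everything is linear: the signed sum of the forms is a single
    inner product of \<open>d b\<close> with \<open>?V w\<close>, which \<open>N\<close> bounds
    uniformly in \<open>b\<close>.\<close>
  have R: "(\<integral>w. (MAX b\<in>T. \<Sum>i\<in>I. 2 * L * (snd (w i) * (d b \<bullet> x (fst (w i))))) \<partial>?Q)
    \<le> 2 * L * (\<integral>w. N (?V w) \<partial>?Q)"
  proof -
    have "(\<Sum>i\<in>I. 2 * L * (snd (w i) * (d b \<bullet> x (fst (w i))))) \<le> 2 * L * N (?V w)"
      if "b \<in> T" for w b
    proof -
      have "(\<Sum>i\<in>I. 2 * L * (snd (w i) * (d b \<bullet> x (fst (w i))))) = 2 * L * (d b \<bullet> ?V w)"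
        by (simp add: inner_sum_right sum_distrib_left)
      also have "\<dots> \<le> 2 * L * N (?V w)" using N[OF that] L by (intro mult_left_mono) auto
      finally show ?thesis .
    qed
    moreover have "integrable ?Q (\<lambda>w. \<Sum>i\<in>I. 2 * L * (snd (w i) * (d b \<bullet> x (fst (w i)))))" for b
      using Q integrable_signed[OF \<mu> u[of b]]
      by (intro Bochner_Integration.integrable_sum integrable_mult_right
          integrable_PiM_component[where h = "\<lambda>w. snd w * (d b \<bullet> x (fst w))"])
    ultimately have "(\<integral>w. (MAX b\<in>T. \<Sum>i\<in>I. 2 * L * (snd (w i) * (d b \<bullet> x (fst (w i))))) \<partial>?Q)
        \<le> (\<integral>w. 2 * L * N (?V w) \<partial>?Q)"
      using T T' int_N by (intro integral_mono integrable_MAX) (auto simp: Max_le_iff)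
    then show ?thesis by simp
  qed
  have comp: "integrable ?P (\<lambda>z. \<Sum>i\<in>I. f b (z i) - (\<integral>z. f b z \<partial>\<mu>))" if "b \<in> T" for b
    using f[OF that] \<mu> by (intro Bochner_Integration.integrable_sum Bochner_Integration.integrable_diff
        integrable_PiM_component) auto
  let ?a = "\<lambda>b z. \<Sum>i\<in>I. f b (z i) - (\<integral>z. f b z \<partial>\<mu>)"
  have neg: "(\<Sum>i\<in>I. - f b (z i) - (\<integral>z. - f b z \<partial>\<mu>)) = - ?a b z" for b z
    by (simp add: sum_subtractf sum_negf)
  have "(\<integral>z. (MAX b\<in>T. \<bar>?a b z\<bar>) \<partial>?P) \<le> (\<integral>z. (MAX b\<in>T. ?a b z) + (MAX b\<in>T. - ?a b z) \<partial>?P)"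
  proof (rule integral_mono)
    fix z
    have z0: "?a b0 z = 0" using b0 by simp
    have nonneg: "0 \<le> (MAX b\<in>T. ?a b z)" "0 \<le> (MAX b\<in>T. - ?a b z)"
      using T b0(1) z0 by (auto intro!: Max_ge_iff[THEN iffD2] bexI[of _ b0])
    have "\<bar>?a b z\<bar> \<le> (MAX b\<in>T. ?a b z) + (MAX b\<in>T. - ?a b z)" if "b \<in> T" for b
    proof -
      have "?a b z \<le> (MAX b\<in>T. ?a b z)" "- ?a b z \<le> (MAX b\<in>T. - ?a b z)"
        using that T by (auto intro!: Max_ge)
      with nonneg show ?thesis by linarith
    qed
    then show "(MAX b\<in>T. \<bar>?a b z\<bar>) \<le> (MAX b\<in>T. ?a b z) + (MAX b\<in>T. - ?a b z)"
      using T T' by (auto simp: Max_le_iff)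
  qed (use comp T T' in \<open>auto intro!: integrable_MAX\<close>)
  also have "\<dots> = (\<integral>z. (MAX b\<in>T. ?a b z) \<partial>?P) + (\<integral>z. (MAX b\<in>T. - ?a b z) \<partial>?P)"
    using comp T T' by (intro Bochner_Integration.integral_add integrable_MAX) auto
  also have "\<dots> \<le> 2 * L * (\<integral>w. N (?V w) \<partial>?Q) + 2 * L * (\<integral>w. N (?V w) \<partial>?Q)"
  proof (rule add_mono)
    show "(\<integral>z. (MAX b\<in>T. ?a b z) \<partial>?P) \<le> 2 * L * (\<integral>w. N (?V w) \<partial>?Q)"
      by (rule order_trans[OF symmetrization_contraction[OF \<mu> T T' L I f u lip] R])
    \<comment> \<open>The lower deviations are the upper deviations of \<open>- f\<close>, which
      satisfies the same Lipschitz condition.\<close>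
    have "(\<integral>z. (MAX b\<in>T. \<Sum>i\<in>I. - f b (z i) - (\<integral>z. - f b z \<partial>\<mu>)) \<partial>?P) \<le> 2 * L * (\<integral>w. N (?V w) \<partial>?Q)"
    proof (rule order_trans[OF symmetrization_contraction[OF \<mu> T T' L I] R])
      fix z b b' assume "z \<in> space \<mu>" "b \<in> T" "b' \<in> T"
      from lip[OF this] show "\<bar>- f b z - - f b' z\<bar> \<le> L * \<bar>d b \<bullet> x z - d b' \<bullet> x z\<bar>" by simp
    qed (use f u in auto)
    then show "(\<integral>z. (MAX b\<in>T. - ?a b z) \<partial>?P) \<le> 2 * L * (\<integral>w. N (?V w) \<partial>?Q)"
      by (simp only: neg)
  qed
  finally show ?thesis by simp
qed

section \<open>Suprema over arbitrary parameter sets\<close>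

lemma measurable_of_continuous_label:
  fixes \<rho> :: "real \<Rightarrow> nat \<Rightarrow> real"
  assumes "\<And>y. y \<in> {0,1} \<Longrightarrow> continuous_on UNIV (\<lambda>u. \<rho> u y)"
  shows "(\<lambda>z. \<rho> (b \<bullet> fst z) (snd z)) \<in> borel_measurable (obs_space :: ((real^'p) \<times> nat) measure)"
proof -
  have [measurable]: "(\<lambda>u. \<rho> u 0) \<in> borel_measurable borel" "(\<lambda>u. \<rho> u 1) \<in> borel_measurable borel"
    using assms by (auto intro!: borel_measurable_continuous_onI)
  have "Measurable.pred (obs_space :: ((real^'p) \<times> nat) measure) (\<lambda>z. snd z = 0)"
    by (rule measurable_compose[OF measurable_snd]) simp
  then have "(\<lambda>z. if snd z = 0 then \<rho> (b \<bullet> fst z) 0 else \<rho> (b \<bullet> fst z) 1)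
      \<in> borel_measurable (obs_space :: ((real^'p) \<times> nat) measure)"
    by measurable
  \<comment> \<open>The two functions agree on the space of \<open>obs_space\<close>, where every
    label is 0 or 1.\<close>
  also have "?this \<longleftrightarrow> ?thesis"
    by (rule measurable_cong) (auto simp: space_pair_measure)
  finally show ?thesis .
qed

text \<open>By continuity the set where \<open>f\<close> stays below the supremum over
  \<open>C\<close> is closed, hence contains the closure of \<open>C\<close>.\<close>

lemma SUP_dense_eq:
  fixes f :: "'b::topological_space \<Rightarrow> real"
  assumes f: "continuous_on UNIV f" and C: "C \<subseteq> A" "A \<subseteq> closure C"
  shows "(SUP b\<in>A. ennreal (f b)) = (SUP b\<in>C. ennreal (f b))"
proof (rule antisym)
  let ?K = "SUP b\<in>C. ennreal (f b)"
  have "closed {b. ennreal (f b) \<le> ?K}"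
    by (intro closed_Collect_le continuous_on_ennreal f continuous_on_const)
  moreover have "C \<subseteq> {b. ennreal (f b) \<le> ?K}" by (auto intro: SUP_upper)
  ultimately have "closure C \<subseteq> {b. ennreal (f b) \<le> ?K}" by (rule closure_minimal[rotated])
  then show "(SUP b\<in>A. ennreal (f b)) \<le> ?K" using C by (intro SUP_least) auto
  show "?K \<le> (SUP b\<in>A. ennreal (f b))" using C by (intro SUP_subset_mono) auto
qed

lemma (in prob_space) Markov_inequality_ennreal:
  fixes K t :: real
  assumes S: "S \<in> borel_measurable M" and t: "t > 0" and K: "(\<integral>\<^sup>+\<omega>. S \<omega> \<partial>M) \<le> ennreal K" "K \<ge> 0"
  shows "\<P>(\<omega> in M. S \<omega> \<ge> ennreal t) \<le> K / t"
proof -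
  have "S \<omega> \<ge> ennreal t \<Longrightarrow> 1 \<le> ennreal (1 / t) * S \<omega>" for \<omega>
    using mult_left_mono[of "ennreal t" "S \<omega>" "ennreal (1 / t)"] t by (simp flip: ennreal_mult)
  then have "emeasure M {\<omega> \<in> space M. S \<omega> \<ge> ennreal t} \<le> emeasure M {\<omega> \<in> space M. 1 \<le> ennreal (1 / t) * S \<omega>}"
    using S by (intro emeasure_mono) auto
  also have "\<dots> \<le> ennreal (1 / t) * (\<integral>\<^sup>+\<omega>. S \<omega> * indicator (space M) \<omega> \<partial>M)"
    using S by (intro nn_integral_Markov_inequality) auto
  also have "(\<integral>\<^sup>+\<omega>. S \<omega> * indicator (space M) \<omega> \<partial>M) = (\<integral>\<^sup>+\<omega>. S \<omega> \<partial>M)"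
    by (intro nn_integral_cong) auto
  also have "ennreal (1 / t) * \<dots> \<le> ennreal (1 / t) * ennreal K" using K by (intro mult_left_mono) auto
  also have "\<dots> = ennreal (K / t)" using t K by (simp flip: ennreal_mult)
  finally show ?thesis using t K by (simp add: emeasure_eq_measure)
qed

lemma integrable_vec:
  fixes x :: "'z \<Rightarrow> real^'p"
  assumes "\<And>j. integrable N (\<lambda>z. x z $ j)"
  shows "integrable N x"
proof -
  have "integrable N (\<lambda>z. \<Sum>j\<in>UNIV. (x z $ j) *\<^sub>R axis j 1 :: real^'p)"
    using assms by (intro Bochner_Integration.integrable_sum integrable_scaleR_left) auto
  also have "(\<lambda>z. \<Sum>j\<in>UNIV. (x z $ j) *\<^sub>R axis j 1 :: real^'p) = x"
    by (simp add: basis_expansion flip: scalar_mult_eq_scaleR)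
  finally show ?thesis .
qed

section \<open>The sample, its law and the deviation process\<close>

locale lipschitz_subgaussian_sample = prob_space M
  for M :: "'a measure" +
  fixes X :: "'a \<Rightarrow> real^'p" and Y :: "'a \<Rightarrow> nat"
    and Xs :: "nat \<Rightarrow> 'a \<Rightarrow> real^'p" and Ys :: "nat \<Rightarrow> 'a \<Rightarrow> nat"
    and \<rho> :: "real \<Rightarrow> nat \<Rightarrow> real" and \<beta> :: "real^'p" and L s :: real and n :: nat
  assumes n_pos: "n \<ge> 1"
    and X_rv: "X \<in> borel_measurable M" and Y_rv: "Y \<in> measurable M (count_space {0,1})"
    and indep: "indep_vars (\<lambda>_. obs_space) (\<lambda>i \<omega>. (Xs i \<omega>, Ys i \<omega>)) {1..n}"
    and copies: "\<And>i. i \<in> {1..n} \<Longrightarrow>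
      distr M obs_space (\<lambda>\<omega>. (Xs i \<omega>, Ys i \<omega>)) = distr M obs_space (\<lambda>\<omega>. (X \<omega>, Y \<omega>))"
    and L_nonneg: "L \<ge> 0" and s_nonneg: "s \<ge> 0"
    and Lipschitz: "\<And>u v y. y \<in> {0,1} \<Longrightarrow> \<bar>\<rho> u y - \<rho> v y\<bar> \<le> L * \<bar>u - v\<bar>"
    and subg: "\<And>i j. i \<in> {1..n} \<Longrightarrow> subgaussian M (\<lambda>\<omega>. Xs i \<omega> $ j) (s\<^sup>2)"
begin

abbreviation loss :: "real^'p \<Rightarrow> (real^'p) \<times> nat \<Rightarrow> real" where
  "loss b z \<equiv> \<rho> (b \<bullet> fst z) (snd z)"

definition \<mu> :: "((real^'p) \<times> nat) measure" where
  "\<mu> = distr M obs_space (\<lambda>\<omega>. (X \<omega>, Y \<omega>))"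

text \<open>Points of the product space are undefined outside the index set, hence the restriction
  to \<open>{1..n}\<close>.\<close>

abbreviation sample :: "'a \<Rightarrow> nat \<Rightarrow> (real^'p) \<times> nat" where
  "sample \<omega> \<equiv> \<lambda>i\<in>{1..n}. (Xs i \<omega>, Ys i \<omega>)"

abbreviation signed_space :: "(nat \<Rightarrow> ((real^'p) \<times> nat) \<times> real) measure" where
  "signed_space \<equiv> PiM {1..n} (\<lambda>_. \<mu> \<Otimes>\<^sub>M rademacher)"

abbreviation signed_sum :: "(nat \<Rightarrow> ((real^'p) \<times> nat) \<times> real) \<Rightarrow> real^'p" where
  "signed_sum w \<equiv> \<Sum>i\<in>{1..n}. snd (w i) *\<^sub>R fst (fst (w i))"

abbreviation dev :: "'a \<Rightarrow> real^'p \<Rightarrow> real" where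
  "dev \<omega> b \<equiv> \<bar>excess (risk M X Y \<rho>) \<beta> b - excess (emp_risk n Xs Ys \<rho> \<omega>) \<beta> b\<bar>"

lemma obs_rv: "(\<lambda>\<omega>. (X \<omega>, Y \<omega>)) \<in> measurable M obs_space"
  using X_rv Y_rv by (rule measurable_Pair)

lemma sample_rv: "i \<in> {1..n} \<Longrightarrow> (\<lambda>\<omega>. (Xs i \<omega>, Ys i \<omega>)) \<in> measurable M obs_space"
  using indep by (auto simp: indep_vars_def)

lemma sets_\<mu> [measurable_cong]: "sets \<mu> = sets obs_space"
  by (simp only: \<mu>_def sets_distr)

lemma space_\<mu>: "space \<mu> = UNIV \<times> {0,1}"
  by (simp add: \<mu>_def space_pair_measure)

lemma prob_space_\<mu>: "prob_space \<mu>"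
  unfolding \<mu>_def by (rule prob_space_distr[OF obs_rv])

text \<open>Independence makes the joint law a product and equality of the laws makes all factors
  \<open>\<mu>\<close>; this moves expectations over \<open>M\<close> to the product measure of the
  symmetrization bound.\<close>

lemma distr_sample: "distr M (PiM {1..n} (\<lambda>_. obs_space)) sample = PiM {1..n} (\<lambda>_. \<mu>)"
proof -
  have "distr M (PiM {1..n} (\<lambda>_. obs_space)) sample
      = PiM {1..n} (\<lambda>i. distr M obs_space (\<lambda>\<omega>. (Xs i \<omega>, Ys i \<omega>)))"
    using indep n_pos sample_rv by (subst (asm) indep_vars_iff_distr_eq_PiM') auto
  also have "\<dots> = PiM {1..n} (\<lambda>_. \<mu>)" using copies by (intro PiM_cong) (auto simp: \<mu>_def)
  finally show ?thesis .
qed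

lemma measurable_sample: "sample \<in> measurable M (PiM {1..n} (\<lambda>_. \<mu>))"
  using sample_rv by (intro measurable_restrict) (simp add: measurable_cong_sets[OF refl sets_\<mu>])

lemma subgaussian_\<mu>: "subgaussian \<mu> (\<lambda>z. fst z $ j) (s\<^sup>2)"
proof -
  \<comment> \<open>Subgaussianity is assumed for the copies; the first one, present because
    \<open>n \<ge> 1\<close>, carries it over to the common law.\<close>
  have \<mu>1: "\<mu> = distr M obs_space (\<lambda>\<omega>. (Xs 1 \<omega>, Ys 1 \<omega>))"
    using copies[of 1] n_pos by (simp add: \<mu>_def)
  have m: "(\<lambda>z. exp (t * fst z $ j)) \<in> borel_measurable (obs_space :: ((real^'p) \<times> nat) measure)" for t
    by (intro measurable_compose[OF measurable_fst] borel_measurable_continuous_onI continuous_intros)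
  have "subgaussian M (\<lambda>\<omega>. Xs 1 \<omega> $ j) (s\<^sup>2)" using n_pos by (intro subg) simp
  then show ?thesis
    using sample_rv[of 1] n_pos m
    by (simp add: subgaussian_def \<mu>1 integrable_distr_eq integral_distr)
qed

lemma integrable_fst_\<mu>: "integrable \<mu> fst"
  by (intro integrable_vec subgaussian_integrable[OF prob_space_\<mu> subgaussian_\<mu>])

lemma loss_Lipschitz: "z \<in> space \<mu> \<Longrightarrow> \<bar>loss b z - loss b' z\<bar> \<le> L * \<bar>b \<bullet> fst z - b' \<bullet> fst z\<bar>"
  by (rule Lipschitz) (auto simp: space_\<mu>)

lemma measurable_loss: "loss b \<in> borel_measurable obs_space"
proof (rule measurable_of_continuous_label)
  fix y :: nat assume y: "y \<in> {0,1}"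
  have "L-lipschitz_on UNIV (\<lambda>u. \<rho> u y)"
    using Lipschitz[OF y] L_nonneg by (auto simp: lipschitz_on_def dist_real_def)
  then show "continuous_on UNIV (\<lambda>u. \<rho> u y)" by (rule lipschitz_on_continuous_on)
qed

text \<open>Comparison with the parameter 0 dominates the loss by a constant plus a multiple of
  \<open>\<bar>b \<bullet> fst z\<bar>\<close>. Hence the risk is a genuine expectation and not the
  default value 0 of a nonintegrable function.\<close>

lemma integrable_loss: "integrable \<mu> (loss b)"
proof -
  interpret \<mu>: prob_space \<mu> by (rule prob_space_\<mu>)
  show ?thesis
  proof (rule Bochner_Integration.integrable_bound)
    show "integrable \<mu> (\<lambda>z. (\<bar>\<rho> 0 0\<bar> + \<bar>\<rho> 0 1\<bar>) + L * \<bar>b \<bullet> fst z\<bar>)"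
      using integrable_fst_\<mu> by auto
    show "loss b \<in> borel_measurable \<mu>"
      using measurable_loss by (simp add: measurable_cong_sets[OF sets_\<mu> refl])
    have "norm (loss b z) \<le> norm ((\<bar>\<rho> 0 0\<bar> + \<bar>\<rho> 0 1\<bar>) + L * \<bar>b \<bullet> fst z\<bar>)" if "z \<in> space \<mu>" for z
      using loss_Lipschitz[OF that, of b 0] that by (auto simp: space_\<mu>)
    then show "AE z in \<mu>. norm (loss b z) \<le> norm ((\<bar>\<rho> 0 0\<bar> + \<bar>\<rho> 0 1\<bar>) + L * \<bar>b \<bullet> fst z\<bar>)"
      by (rule AE_I2)
  qed
qed

lemma risk_eq: "risk M X Y \<rho> b = (\<integral>z. loss b z \<partial>\<mu>)"
  unfolding risk_def \<mu>_def by (subst integral_distr[OF obs_rv measurable_loss]) simp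

lemma emp_risk_eq: "emp_risk n Xs Ys \<rho> \<omega> b = (\<Sum>i\<in>{1..n}. loss b (sample \<omega> i)) / n"
  by (simp add: emp_risk_def)

text \<open>Brings the deviation into the form of a centred sum, as in
  \<open>expected_abs_deviation_le\<close>. Empirical and true risk change places, which the
  absolute value absorbs.\<close>

lemma dev_eq:
  "dev \<omega> b = \<bar>\<Sum>i\<in>{1..n}. (loss b (sample \<omega> i) - loss \<beta> (sample \<omega> i)) - (\<integral>z. loss b z - loss \<beta> z \<partial>\<mu>)\<bar> / n"
proof -
  define A B where "A = (\<Sum>i\<in>{1..n}. loss b (sample \<omega> i))" and "B = (\<Sum>i\<in>{1..n}. loss \<beta> (sample \<omega> i))"
  have "(\<Sum>i\<in>{1..n}. (loss b (sample \<omega> i) - loss \<beta> (sample \<omega> i)) - (\<integral>z. loss b z - loss \<beta> z \<partial>\<mu>))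
    = A - B - real n * (risk M X Y \<rho> b - risk M X Y \<rho> \<beta>)"
    unfolding A_def B_def using integrable_loss by (simp only: sum_subtractf) (simp add: risk_eq algebra_simps)
  also have "\<dots> = - (real n * (excess (risk M X Y \<rho>) \<beta> b - excess (emp_risk n Xs Ys \<rho> \<omega>) \<beta> b))"
    using n_pos unfolding excess_def emp_risk_eq A_def[symmetric] B_def[symmetric] by (simp add: field_simps)
  finally have "(\<Sum>i\<in>{1..n}. (loss b (sample \<omega> i) - loss \<beta> (sample \<omega> i)) - (\<integral>z. loss b z - loss \<beta> z \<partial>\<mu>))
    = - (real n * (excess (risk M X Y \<rho>) \<beta> b - excess (emp_risk n Xs Ys \<rho> \<omega>) \<beta> b))" .
  moreover have "real n > 0" using n_pos by simp
  ultimately show ?thesis by (simp add: abs_mult)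
qed

text \<open>The Lipschitz condition survives integration, with the mean norm of the predictor as an
  additional factor. Continuity in the parameter is what allows suprema to be taken over countable
  dense sets.\<close>

lemma continuous_risk: "continuous_on UNIV (risk M X Y \<rho>)"
proof (rule lipschitz_on_continuous_on)
  let ?K = "L * (\<integral>z. norm (fst z) \<partial>\<mu>)"
  have int: "integrable \<mu> (\<lambda>z. norm (fst z))" using integrable_fst_\<mu> by simp
  show "?K-lipschitz_on UNIV (risk M X Y \<rho>)"
  proof (rule lipschitz_onI)
    fix b b' :: "real^'p"
    have "dist (risk M X Y \<rho> b) (risk M X Y \<rho> b') = \<bar>\<integral>z. loss b z - loss b' z \<partial>\<mu>\<bar>"
      using integrable_loss by (simp add: risk_eq dist_real_def)
    also have "\<dots> \<le> (\<integral>z. \<bar>loss b z - loss b' z\<bar> \<partial>\<mu>)" by (rule integral_abs_bound)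
    also have "\<dots> \<le> (\<integral>z. L * dist b b' * norm (fst z) \<partial>\<mu>)"
    proof (rule integral_mono)
      fix z assume z: "z \<in> space \<mu>"
      have "\<bar>b \<bullet> fst z - b' \<bullet> fst z\<bar> \<le> norm (b - b') * norm (fst z)"
        using Cauchy_Schwarz_ineq2[of "b - b'" "fst z"] by (simp add: inner_diff_left)
      then have "L * \<bar>b \<bullet> fst z - b' \<bullet> fst z\<bar> \<le> L * (norm (b - b') * norm (fst z))"
        using L_nonneg by (rule mult_left_mono)
      with loss_Lipschitz[OF z, of b b'] show "\<bar>loss b z - loss b' z\<bar> \<le> L * dist b b' * norm (fst z)"
        by (simp add: dist_norm mult.assoc)
    qed (use int integrable_loss in auto)
    finally show "dist (risk M X Y \<rho> b) (risk M X Y \<rho> b') \<le> ?K * dist b b'" by (simp add: mult_ac)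
  qed (use L_nonneg in simp)
qed

lemma continuous_emp_risk:
  assumes \<omega>: "\<omega> \<in> space M"
  shows "continuous_on UNIV (emp_risk n Xs Ys \<rho> \<omega>)"
proof -
  have "continuous_on UNIV (\<lambda>b. loss b (Xs i \<omega>, Ys i \<omega>))" if i: "i \<in> {1..n}" for i
  proof -
    \<comment> \<open>Only outcomes in the space of \<open>M\<close> are known to have labels to
      which the Lipschitz condition applies.\<close>
    have y: "Ys i \<omega> \<in> {0,1}"
      using measurable_space[OF sample_rv[OF i] \<omega>] by (simp add: space_pair_measure)
    have "L-lipschitz_on UNIV (\<lambda>u. \<rho> u (Ys i \<omega>))"
      using Lipschitz[OF y] L_nonneg by (auto simp: lipschitz_on_def dist_real_def)
    then have "continuous_on UNIV (\<lambda>u. \<rho> u (Ys i \<omega>))" by (rule lipschitz_on_continuous_on)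
    then show ?thesis
      by (auto intro!: continuous_on_compose2[of UNIV "\<lambda>u. \<rho> u (Ys i \<omega>)"] continuous_intros)
  qed
  then show ?thesis unfolding emp_risk_def[abs_def] using n_pos by (auto intro!: continuous_intros)
qed

lemma continuous_dev: "\<omega> \<in> space M \<Longrightarrow> continuous_on UNIV (dev \<omega>)"
  unfolding excess_def using continuous_risk continuous_emp_risk by (intro continuous_intros) auto

lemma measurable_dev: "(\<lambda>\<omega>. dev \<omega> b) \<in> borel_measurable M"
proof -
  have "(\<lambda>\<omega>. loss b' (sample \<omega> i)) \<in> borel_measurable M" if "i \<in> {1..n}" for i b'
    using measurable_compose[OF sample_rv[OF that] measurable_loss[of b']] that by simp
  then show ?thesis unfolding dev_eq by (intro borel_measurable_divide borel_measurable_abs borel_measurable_sum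
    borel_measurable_diff) auto
qed

text \<open>For fixed \<open>D\<close> and \<open>B\<close> the supremum equals one over a countable
  dense subset.\<close>

lemma measurable_sup_dev:
  "(\<lambda>\<omega>. sup_dev (risk M X Y \<rho>) (emp_risk n Xs Ys \<rho> \<omega>) \<beta> D B) \<in> borel_measurable M"
proof -
  obtain C where C: "countable C" "C \<subseteq> {b\<in>D. b - \<beta> \<in> B}" "{b\<in>D. b - \<beta> \<in> B} \<subseteq> closure C"
    by (rule separable)
  have "(\<lambda>\<omega>. SUP b\<in>C. ennreal (dev \<omega> b)) \<in> borel_measurable M"
    using C(1) measurable_dev by (intro borel_measurable_SUP) auto
  also have "?this \<longleftrightarrow> ?thesis"
    unfolding sup_dev_def
    by (intro measurable_cong SUP_dense_eq[OF continuous_dev C(2,3), symmetric])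
  finally show ?thesis .
qed

section \<open>Expected suprema and the general tail bound\<close>

lemma expected_MAX_dev:
  assumes T: "finite T" "\<beta> \<in> T" and N: "\<And>b v. b \<in> T \<Longrightarrow> (b - \<beta>) \<bullet> v \<le> N v"
    and int_N: "integrable signed_space (\<lambda>w. N (signed_sum w))"
  shows "(\<integral>\<^sup>+\<omega>. ennreal (MAX b\<in>T. dev \<omega> b) \<partial>M) \<le> ennreal (4 * L * (\<integral>w. N (signed_sum w) \<partial>signed_space) / n)"
proof -
  let ?h = "\<lambda>z. MAX b\<in>T. \<bar>\<Sum>i\<in>{1..n}. (loss b (z i) - loss \<beta> (z i)) - (\<integral>z. loss b z - loss \<beta> z \<partial>\<mu>)\<bar>"
  let ?P = "PiM {1..n} (\<lambda>_. \<mu>)"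
  have T': "T \<noteq> {}" using T by auto
  interpret P: prob_space ?P by (intro prob_space_PiM prob_space_\<mu>)
  have int_h: "integrable ?P ?h"
    using integrable_loss prob_space_\<mu> T T'
    by (intro integrable_MAX integrable_abs Bochner_Integration.integrable_sum
        Bochner_Integration.integrable_diff integrable_PiM_component[where h = "loss _"] P.integrable_const) auto
  have distr: "distr M ?P sample = ?P"
    using distr_sample by (simp cong: distr_cong sets_PiM_cong add: sets_\<mu>)
  have h_ge: "0 \<le> ?h z" for z using T by (intro Max_ge_iff[THEN iffD2]) auto
  have MAX_dev: "(MAX b\<in>T. dev \<omega> b) = (1 / n) * ?h (sample \<omega>)" for \<omega>
    unfolding dev_eq using T T' MAX_scale[of T "1 / n"] by simp
  have "integrable M (\<lambda>\<omega>. ?h (sample \<omega>))"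
    using int_h integrable_distr_eq[OF measurable_sample, of ?h] distr by simp
  then have "(\<integral>\<^sup>+\<omega>. ennreal (MAX b\<in>T. dev \<omega> b) \<partial>M) = ennreal (\<integral>\<omega>. (1 / n) * ?h (sample \<omega>) \<partial>M)"
    unfolding MAX_dev by (intro nn_integral_eq_integral integrable_mult_right AE_I2 mult_nonneg_nonneg h_ge) auto
  also have "(\<integral>\<omega>. (1 / n) * ?h (sample \<omega>) \<partial>M) = (1 / n) * (\<integral>\<omega>. ?h (sample \<omega>) \<partial>M)"
    by (rule integral_mult_right_zero)
  also have "(\<integral>\<omega>. ?h (sample \<omega>) \<partial>M) = (\<integral>z. ?h z \<partial>?P)"
    using integral_distr[OF measurable_sample, of ?h] int_h distr by simp
  also have "ennreal ((1 / n) * (\<integral>z. ?h z \<partial>?P)) \<le> ennreal ((1 / n) * (4 * L * (\<integral>w. N (signed_sum w) \<partial>signed_space)))"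
  proof (intro ennreal_leI mult_left_mono)
    show "(\<integral>z. ?h z \<partial>?P) \<le> 4 * L * (\<integral>w. N (signed_sum w) \<partial>signed_space)"
    \<comment> \<open>The point \<open>\<beta>\<close> serves as \<open>b0\<close>, since the loss
      difference vanishes there, and subtracting the loss at \<open>\<beta>\<close> leaves its
      increments unchanged.\<close>
    proof (rule expected_abs_deviation_le[where f = "\<lambda>b z. loss b z - loss \<beta> z" and d = "\<lambda>b. b - \<beta>" and ?b0.0 = \<beta>])
      fix z b b' assume "z \<in> space \<mu>"
      from loss_Lipschitz[OF this, of b b']
      show "\<bar>(loss b z - loss \<beta> z) - (loss b' z - loss \<beta> z)\<bar> \<le> L * \<bar>(b - \<beta>) \<bullet> fst z - (b' - \<beta>) \<bullet> fst z\<bar>"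
        by (simp add: inner_diff_left)
    qed (use prob_space_\<mu> T L_nonneg integrable_loss integrable_fst_\<mu> N int_N in auto)
  qed simp
  finally show ?thesis by simp
qed

text \<open>The bound for finite sets does not depend on the set, so it passes to an increasing
  union of finite sets by monotone convergence.\<close>

lemma expected_sup_dev:
  assumes \<beta>: "\<beta> \<in> D" "0 \<in> B" and N: "\<And>b v. b \<in> D \<Longrightarrow> b - \<beta> \<in> B \<Longrightarrow> (b - \<beta>) \<bullet> v \<le> N v"
    and int_N: "integrable signed_space (\<lambda>w. N (signed_sum w))"
  shows "(\<integral>\<^sup>+\<omega>. sup_dev (risk M X Y \<rho>) (emp_risk n Xs Ys \<rho> \<omega>) \<beta> D B \<partial>M)
    \<le> ennreal (4 * L * (\<integral>w. N (signed_sum w) \<partial>signed_space) / n)"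
proof -
  let ?A = "{b\<in>D. b - \<beta> \<in> B}"
  obtain C where C: "countable C" "C \<subseteq> ?A" "?A \<subseteq> closure C"
    by (rule separable)
  have "?A \<noteq> {}" using \<beta> by auto
  then have C': "C \<noteq> {}" using C by auto
  \<comment> \<open>The first \<open>m + 1\<close> members of an enumeration of the dense set,
    together with \<open>\<beta>\<close>, which the finite bound requires and which need not lie in
    \<open>C\<close>.\<close>
  define T where "T m = insert \<beta> (from_nat_into C ` {..m})" for m
  have T: "finite (T m)" "\<beta> \<in> T m" "T m \<noteq> {}" "T m \<subseteq> ?A" for m
    using C C' \<beta> from_nat_into[OF C'] by (auto simp: T_def)
  have "(\<integral>\<^sup>+\<omega>. sup_dev (risk M X Y \<rho>) (emp_risk n Xs Ys \<rho> \<omega>) \<beta> D B \<partial>M)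
      \<le> (\<integral>\<^sup>+\<omega>. (SUP m. ennreal (MAX b\<in>T m. dev \<omega> b)) \<partial>M)"
  proof (rule nn_integral_mono)
    fix \<omega> assume \<omega>: "\<omega> \<in> space M"
    have "sup_dev (risk M X Y \<rho>) (emp_risk n Xs Ys \<rho> \<omega>) \<beta> D B = (SUP b\<in>C. ennreal (dev \<omega> b))"
      unfolding sup_dev_def by (rule SUP_dense_eq[OF continuous_dev[OF \<omega>] C(2,3)])
    also have "\<dots> \<le> (SUP m. ennreal (MAX b\<in>T m. dev \<omega> b))"
    proof (rule SUP_least)
      fix b assume "b \<in> C"
      then obtain m where "b = from_nat_into C m" using C(1) by (metis from_nat_into_surj)
      then have "b \<in> T m" by (simp add: T_def)
      then have "ennreal (dev \<omega> b) \<le> ennreal (MAX b\<in>T m. dev \<omega> b)"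
        using T by (intro ennreal_leI Max_ge) auto
      then show "ennreal (dev \<omega> b) \<le> (SUP m. ennreal (MAX b\<in>T m. dev \<omega> b))"
        by (rule order_trans[OF _ SUP_upper]) simp
    qed
    finally show "sup_dev (risk M X Y \<rho>) (emp_risk n Xs Ys \<rho> \<omega>) \<beta> D B \<le> (SUP m. ennreal (MAX b\<in>T m. dev \<omega> b))" .
  qed
  also have "\<dots> = (SUP m. (\<integral>\<^sup>+\<omega>. ennreal (MAX b\<in>T m. dev \<omega> b) \<partial>M))"
  proof (rule nn_integral_monotone_convergence_SUP)
    show "incseq (\<lambda>m \<omega>. ennreal (MAX b\<in>T m. dev \<omega> b))"
    proof (intro incseq_SucI le_funI ennreal_leI Max_mono)
      show "dev \<omega> ` T m \<subseteq> dev \<omega> ` T (Suc m)" for m \<omega> by (auto simp: T_def intro!: image_mono)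
    qed (use T in auto)
    show "(\<lambda>\<omega>. ennreal (MAX b\<in>T m. dev \<omega> b)) \<in> borel_measurable M" for m
      using T measurable_dev by (intro measurable_compose[OF _ measurable_ennreal] borel_measurable_Max) auto
  qed
  also have "\<dots> \<le> ennreal (4 * L * (\<integral>w. N (signed_sum w) \<partial>signed_space) / n)"
    using T N int_N by (intro SUP_least expected_MAX_dev) blast+
  finally show ?thesis .
qed

text \<open>Markov's inequality. It remains to choose \<open>N\<close> for each geometry and to
  bound its mean by some \<open>K\<close>.\<close>

lemma sup_dev_tail:
  fixes K t :: real
  assumes \<beta>: "\<beta> \<in> D" "0 \<in> B" and N: "\<And>b v. b \<in> D \<Longrightarrow> b - \<beta> \<in> B \<Longrightarrow> (b - \<beta>) \<bullet> v \<le> N v"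
    and int_N: "integrable signed_space (\<lambda>w. N (signed_sum w))"
    and K: "(\<integral>w. N (signed_sum w) \<partial>signed_space) \<le> K" "K \<ge> 0" and t: "t > 0"
  shows "\<P>(\<omega> in M. sup_dev (risk M X Y \<rho>) (emp_risk n Xs Ys \<rho> \<omega>) \<beta> D B \<ge> ennreal t) \<le> 4 * L * K / (n * t)"
proof -
  have "4 * L * (\<integral>w. N (signed_sum w) \<partial>signed_space) / n \<le> 4 * L * K / n"
    using K L_nonneg by (intro divide_right_mono mult_left_mono) auto
  with expected_sup_dev[OF \<beta> N int_N]
  have "(\<integral>\<^sup>+\<omega>. sup_dev (risk M X Y \<rho>) (emp_risk n Xs Ys \<rho> \<omega>) \<beta> D B \<partial>M) \<le> ennreal (4 * L * K / n)"
    by (meson ennreal_leI order_trans)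
  note le = this
  have "\<P>(\<omega> in M. sup_dev (risk M X Y \<rho>) (emp_risk n Xs Ys \<rho> \<omega>) \<beta> D B \<ge> ennreal t) \<le> (4 * L * K / n) / t"
    using K L_nonneg by (intro Markov_inequality_ennreal measurable_sup_dev t le) auto
  then show ?thesis by simp
qed

section \<open>Norms of the signed sum and the two explicit tail bounds\<close>

lemma prob_space_signed_space: "prob_space signed_space"
  by (intro prob_space_PiM prob_space_pair prob_space_\<mu> measure_pmf.prob_space_axioms)

lemma subgaussian_signed_sum: "subgaussian signed_space (\<lambda>w. signed_sum w $ j) (n * s\<^sup>2)"
  using subgaussian_sum_PiM[OF prob_space_pair[OF prob_space_\<mu> measure_pmf.prob_space_axioms]
      subgaussian_signed[OF prob_space_\<mu> subgaussian_\<mu>[of j]], of "{1..n}"]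
  by simp

text \<open>On an l1 ball the linear form is at most \<open>r\<close> times the maximum norm of
  \<open>v\<close>, by Hoelder's inequality. The constant 8 is the 4 of symmetrization times the 2
  of \<open>subgaussian_MAX_abs\<close>.\<close>

lemma sup_dev_l1_tail:
  fixes r t :: real
  assumes r: "r \<ge> 0" and t: "t > 0"
  shows "\<P>(\<omega> in M. sup_dev (risk M X Y \<rho>) (emp_risk n Xs Ys \<rho> \<omega>) \<beta> UNIV (l1_ball r) \<ge> ennreal t)
    \<le> 8 * L * r * s * sqrt (ln (real (max CARD('p) 2))) / (t * sqrt n)"
proof -
  let ?m = "\<lambda>v :: real^'p. MAX j\<in>UNIV. \<bar>v $ j\<bar>"
  let ?P = "ln (real (max CARD('p) 2))"
  have v: "real n * s\<^sup>2 \<ge> 0" by simp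
  note max_abs = subgaussian_MAX_abs[OF prob_space_signed_space finite UNIV_not_empty v subgaussian_signed_sum]
  have int: "integrable signed_space (\<lambda>w. ?m (signed_sum w))" by (rule max_abs(1))
  have le: "(\<integral>w. ?m (signed_sum w) \<partial>signed_space) \<le> 2 * sqrt (n * s\<^sup>2 * ?P)" by (rule max_abs(2))
  have "\<P>(\<omega> in M. sup_dev (risk M X Y \<rho>) (emp_risk n Xs Ys \<rho> \<omega>) \<beta> UNIV (l1_ball r) \<ge> ennreal t)
    \<le> 4 * L * (r * (2 * sqrt (n * s\<^sup>2 * ?P))) / (n * t)"
  proof (rule sup_dev_tail[where N = "\<lambda>v. r * ?m v"])
    show "0 \<in> l1_ball r" using r by (simp add: l1_ball_def)
    fix b v :: "real^'p" assume b: "b - \<beta> \<in> l1_ball r"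
    have m: "\<bar>v $ j\<bar> \<le> ?m v" for j by (intro Max_ge) auto
    have "(b - \<beta>) \<bullet> v \<le> (\<Sum>j\<in>UNIV. \<bar>(b - \<beta>) $ j\<bar> * \<bar>v $ j\<bar>)"
      unfolding inner_vec_def by (intro sum_mono) (simp only: inner_real_def abs_mult[symmetric] abs_ge_self)
    also have "\<dots> \<le> (\<Sum>j\<in>UNIV. \<bar>(b - \<beta>) $ j\<bar> * ?m v)"
      using m by (intro sum_mono mult_left_mono) auto
    also have "\<dots> = (\<Sum>j\<in>UNIV. \<bar>(b - \<beta>) $ j\<bar>) * ?m v" by (simp add: sum_distrib_right)
    also have "\<dots> \<le> r * ?m v"
      using b order_trans[OF abs_ge_zero m] by (intro mult_right_mono) (auto simp: l1_ball_def)
    finally show "(b - \<beta>) \<bullet> v \<le> r * ?m v" .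
  next
    show "(\<integral>w. r * ?m (signed_sum w) \<partial>signed_space) \<le> r * (2 * sqrt (n * s\<^sup>2 * ?P))"
      unfolding integral_mult_right_zero using le r by (intro mult_left_mono)
  qed (use r t int s_nonneg in auto)
  also have "\<dots> = 8 * L * r * s * sqrt ?P / (t * (real n / sqrt n))"
    using n_pos s_nonneg by (simp add: real_sqrt_mult field_simps)
  also have "real n / sqrt n = sqrt n" by (simp add: real_div_sqrt)
  finally show ?thesis .
qed

text \<open>Here \<open>b - \<beta>\<close> lives on \<open>supp \<beta>\<close>, so by
  Cauchy-Schwarz only the Euclidean norm of \<open>v\<close> on these coordinates enters; this puts
  \<open>card (supp \<beta>)\<close> in place of the dimension.\<close>

lemma sup_dev_support_tail:
  fixes r t :: real
  assumes r: "r \<ge> 0" and t: "t > 0"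
  shows "\<P>(\<omega> in M. sup_dev (risk M X Y \<rho>) (emp_risk n Xs Ys \<rho> \<omega>) \<beta> (D2 \<beta>) (l2_ball r) \<ge> ennreal t)
    \<le> 4 * L * r * s * sqrt (card (supp \<beta>)) / (t * sqrt n)"
proof -
  let ?m = "\<lambda>v :: real^'p. L2_set (\<lambda>j. v $ j) (supp \<beta>)"
  note l2 = subgaussian_L2[OF prob_space_signed_space finite subgaussian_signed_sum]
  have int: "integrable signed_space (\<lambda>w. ?m (signed_sum w))" by (rule l2(1))
  have le: "(\<integral>w. ?m (signed_sum w) \<partial>signed_space) \<le> sqrt (card (supp \<beta>) * (n * s\<^sup>2))" by (rule l2(2))
  have "\<P>(\<omega> in M. sup_dev (risk M X Y \<rho>) (emp_risk n Xs Ys \<rho> \<omega>) \<beta> (D2 \<beta>) (l2_ball r) \<ge> ennreal t)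
    \<le> 4 * L * (r * sqrt (card (supp \<beta>) * (n * s\<^sup>2))) / (n * t)"
  proof (rule sup_dev_tail[where N = "\<lambda>v. r * ?m v"])
    show "0 \<in> l2_ball r" using r by (simp add: l2_ball_def)
    fix b v :: "real^'p" assume b: "b \<in> D2 \<beta>" "b - \<beta> \<in> l2_ball r"
    have zero: "(b - \<beta>) $ j = 0" if "j \<notin> supp \<beta>" for j
      using b that by (auto simp: D2_def supp_def)
    have "(b - \<beta>) \<bullet> v = (\<Sum>j\<in>supp \<beta>. (b - \<beta>) $ j * v $ j)"
      unfolding inner_vec_def using zero by (intro sum.mono_neutral_cong_right) auto
    also have "\<dots> \<le> (\<Sum>j\<in>supp \<beta>. \<bar>(b - \<beta>) $ j\<bar> * \<bar>v $ j\<bar>)"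
      by (intro sum_mono) (simp only: inner_real_def abs_mult[symmetric] abs_ge_self)
    also have "\<dots> \<le> L2_set (\<lambda>j. (b - \<beta>) $ j) (supp \<beta>) * ?m v" by (rule L2_set_mult_ineq)
    also have "L2_set (\<lambda>j. (b - \<beta>) $ j) (supp \<beta>) \<le> norm (b - \<beta>)"
      unfolding norm_vec_def L2_set_def by (intro real_sqrt_le_mono) (simp add: sum_mono2)
    also have "norm (b - \<beta>) \<le> r" using b by (simp add: l2_ball_def)
    finally show "(b - \<beta>) \<bullet> v \<le> r * ?m v" by (simp add: mult_right_mono)
  next
    show "(\<integral>w. r * ?m (signed_sum w) \<partial>signed_space) \<le> r * sqrt (card (supp \<beta>) * (n * s\<^sup>2))"
      unfolding integral_mult_right_zero using le r by (intro mult_left_mono)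
  qed (use r t int s_nonneg in \<open>auto simp: D2_def\<close>)
  also have "\<dots> = 4 * L * r * s * sqrt (card (supp \<beta>)) / (t * (real n / sqrt n))"
    using n_pos s_nonneg by (simp add: real_sqrt_mult field_simps)
  also have "real n / sqrt n = sqrt n" by (simp add: real_div_sqrt)
  finally show ?thesis .
qed

end

text \<open>A difference \<open>b - \<beta>\<close> supported on \<open>w\<close> with
  \<open>card w \<le> k\<close> has l1 norm at most \<open>sqrt k\<close> times its l2 norm, by
  Cauchy-Schwarz against the constant 1. The resulting bound is free of the family \<open>F\<close>,
  so a random choice of \<open>F\<close> is harmless.\<close>

lemma sup_dev_D1_le:
  "sup_dev R Rn \<beta> (D1 \<beta> k F) (l2_ball r) \<le> sup_dev R Rn \<beta> UNIV (l1_ball (sqrt k * r))"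
  unfolding sup_dev_def
proof (rule SUP_subset_mono)
  show "{b \<in> D1 \<beta> k F. b - \<beta> \<in> l2_ball r} \<subseteq> {b \<in> UNIV. b - \<beta> \<in> l1_ball (sqrt k * r)}"
  proof safe
    fix b assume "b \<in> D1 \<beta> k F" and r: "b - \<beta> \<in> l2_ball r"
    then obtain w where w: "card w \<le> k" "supp \<beta> \<subseteq> w" "supp b \<subseteq> w" by (auto simp: D1_def)
    have "(\<Sum>j\<in>UNIV. \<bar>(b - \<beta>) $ j\<bar>) = (\<Sum>j\<in>w. \<bar>1\<bar> * \<bar>(b - \<beta>) $ j\<bar>)"
    proof (rule sum.mono_neutral_cong_right)
      have "(b - \<beta>) $ j = 0" if "j \<notin> w" for j
      proof -
        have "j \<notin> supp b" "j \<notin> supp \<beta>" using that w by auto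
        then show ?thesis by (simp add: supp_def)
      qed
      then show "\<forall>j\<in>UNIV - w. \<bar>(b - \<beta>) $ j\<bar> = 0" by simp
    qed auto
    also have "\<dots> \<le> L2_set (\<lambda>_. 1) w * L2_set (\<lambda>j. (b - \<beta>) $ j) w" by (rule L2_set_mult_ineq)
    also have "\<dots> \<le> sqrt k * norm (b - \<beta>)"
      unfolding norm_vec_def using w
      by (intro mult_mono) (auto simp: L2_set_def intro!: real_sqrt_le_mono sum_mono2 sum_nonneg)
    also have "\<dots> \<le> sqrt k * r" using r by (intro mult_left_mono) (auto simp: l2_ball_def)
    finally show "b - \<beta> \<in> l1_ball (sqrt k * r)" by (simp add: l1_ball_def)
  qed simp
qed simp

theorem lemma2:
  fixes M :: "'a measure"
    and X :: "'a \<Rightarrow> real^'p" and Y :: "'a \<Rightarrow> nat"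
    and Xs :: "nat \<Rightarrow> 'a \<Rightarrow> real^'p" and Ys :: "nat \<Rightarrow> 'a \<Rightarrow> nat"
    and \<rho> :: "real \<Rightarrow> nat \<Rightarrow> real" and \<beta> :: "real^'p"
    and Fam :: "'a \<Rightarrow> 'p set set"
    and \<sigma> :: "'p \<Rightarrow> real" and L s r t :: real and n k :: nat
  assumes prob: "prob_space M"
    and n_pos: "n \<ge> 1" and k_pos: "k \<ge> 1"
    and X_rv: "X \<in> borel_measurable M"
    and Y_rv: "Y \<in> measurable M (count_space {0,1})"
    and indep: "prob_space.indep_vars M (\<lambda>_. obs_space) (\<lambda>i \<omega>. (Xs i \<omega>, Ys i \<omega>)) {1..n}"
    and copies: "\<And>i. i \<in> {1..n} \<Longrightarrow>
      distr M obs_space (\<lambda>\<omega>. (Xs i \<omega>, Ys i \<omega>)) = distr M obs_space (\<lambda>\<omega>. (X \<omega>, Y \<omega>))"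
    and nondegenerate: "\<And>v. v \<noteq> 0 \<Longrightarrow> \<not> (\<exists>c. AE \<omega> in M. v \<bullet> X \<omega> = c)"
    and unique_min: "\<And>b. is_arg_min (risk M X Y \<rho>) (\<lambda>_. True) b \<longleftrightarrow> b = \<beta>"
    and Fam_rv: "Fam \<in> measurable M (count_space UNIV)"
    and Fam: "AE \<omega> in M. supp \<beta> \<in> Fam \<omega> \<and> (\<forall>w\<in>Fam \<omega>. card w \<le> k)"
    and convex: "\<And>y. y \<in> {0,1} \<Longrightarrow> convex_on UNIV (\<lambda>u. \<rho> u y)"
    and L_pos: "L > 0"
    and Lipschitz: "\<And>u v y. y \<in> {0,1} \<Longrightarrow> \<bar>\<rho> u y - \<rho> v y\<bar> \<le> L * \<bar>u - v\<bar>"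
    and subg: "\<And>i j. i \<in> {1..n} \<Longrightarrow> subgaussian M (\<lambda>\<omega>. Xs i \<omega> $ j) ((\<sigma> j)\<^sup>2)"
    and sigma: "\<And>j. 0 \<le> \<sigma> j" "\<And>j. \<sigma> j \<le> s"
    and r_pos: "r > 0" and t_pos: "t > 0"
  defines "S \<equiv> \<lambda>\<omega>. sup_dev (risk M X Y \<rho>) (emp_risk n Xs Ys \<rho> \<omega>) \<beta> UNIV (l1_ball r)"
    and "S1 \<equiv> \<lambda>\<omega>. sup_dev (risk M X Y \<rho>) (emp_risk n Xs Ys \<rho> \<omega>) \<beta> (D1 \<beta> k (Fam \<omega>)) (l2_ball r)"
    and "S2 \<equiv> \<lambda>\<omega>. sup_dev (risk M X Y \<rho>) (emp_risk n Xs Ys \<rho> \<omega>) \<beta> (D2 \<beta>) (l2_ball r)"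
  shows "S \<in> borel_measurable M \<and> S1 \<in> borel_measurable M \<and> S2 \<in> borel_measurable M \<and>
    \<P>(\<omega> in M. S \<omega> > ennreal t)
      \<le> 8 * L * r * s * sqrt (ln (real (max CARD('p) 2))) / (t * sqrt (real n)) \<and>
    \<P>(\<omega> in M. S1 \<omega> \<ge> ennreal t)
      \<le> 8 * L * r * s * sqrt (real k * ln (real (max CARD('p) 2))) / (t * sqrt (real n)) \<and>
    \<P>(\<omega> in M. S2 \<omega> \<ge> ennreal t)
      \<le> 4 * L * r * s * sqrt (real (card (supp \<beta>))) / (t * sqrt (real n))"
proof -
  have s_nonneg: "s \<ge> 0" using sigma order_trans by blast
  interpret lipschitz_subgaussian_sample M X Y Xs Ys \<rho> \<beta> L s n
  proof (intro lipschitz_subgaussian_sample.intro lipschitz_subgaussian_sample_axioms.intro)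
    show "subgaussian M (\<lambda>\<omega>. Xs i \<omega> $ j) (s\<^sup>2)" if "i \<in> {1..n}" for i j
      using subg[OF that] by (rule subgaussian_mono) (use sigma in \<open>auto intro: power_mono\<close>)
  qed (fact prob n_pos X_rv Y_rv indep copies Lipschitz s_nonneg less_imp_le[OF L_pos])+
  have S: "S \<in> borel_measurable M" and S2: "S2 \<in> borel_measurable M"
    unfolding S_def S2_def by (rule measurable_sup_dev)+
  \<comment> \<open>The random family takes values in a finite type, so \<open>S1\<close> is pieced
    together from countably many suprema, each over a fixed family.\<close>
  have S1: "S1 \<in> borel_measurable M"
    unfolding S1_def by (rule measurable_compose_countable[OF measurable_sup_dev Fam_rv])
  have "\<P>(\<omega> in M. S \<omega> > ennreal t) \<le> \<P>(\<omega> in M. S \<omega> \<ge> ennreal t)"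
    using S by (intro finite_measure_mono) auto
  also have "\<dots> \<le> 8 * L * r * s * sqrt (ln (real (max CARD('p) 2))) / (t * sqrt (real n))"
    unfolding S_def using r_pos t_pos by (intro sup_dev_l1_tail) auto
  finally have tail: "\<P>(\<omega> in M. S \<omega> > ennreal t)
    \<le> 8 * L * r * s * sqrt (ln (real (max CARD('p) 2))) / (t * sqrt (real n))" .
  \<comment> \<open>The data-dependent supremum is replaced by one over the deterministic l1 ball of
    radius \<open>sqrt k * r\<close>; the factor \<open>sqrt k\<close> later moves under the
    root.\<close>
  have "\<P>(\<omega> in M. S1 \<omega> \<ge> ennreal t)
    \<le> \<P>(\<omega> in M. sup_dev (risk M X Y \<rho>) (emp_risk n Xs Ys \<rho> \<omega>) \<beta> UNIV (l1_ball (sqrt k * r)) \<ge> ennreal t)"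
  proof (rule finite_measure_mono)
    show "{\<omega> \<in> space M. ennreal t \<le> S1 \<omega>} \<subseteq> {\<omega> \<in> space M. ennreal t
        \<le> sup_dev (risk M X Y \<rho>) (emp_risk n Xs Ys \<rho> \<omega>) \<beta> UNIV (l1_ball (sqrt k * r))}"
      unfolding S1_def using sup_dev_D1_le order_trans by blast
  qed (use measurable_sup_dev in measurable)
  also have "\<dots> \<le> 8 * L * (sqrt k * r) * s * sqrt (ln (real (max CARD('p) 2))) / (t * sqrt (real n))"
    using r_pos t_pos by (intro sup_dev_l1_tail) auto
  also have "\<dots> = 8 * L * r * s * sqrt (real k * ln (real (max CARD('p) 2))) / (t * sqrt (real n))"
    by (simp add: real_sqrt_mult mult_ac)
  finally have tail1: "\<P>(\<omega> in M. S1 \<omega> \<ge> ennreal t)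
    \<le> 8 * L * r * s * sqrt (real k * ln (real (max CARD('p) 2))) / (t * sqrt (real n))" .
  have "\<P>(\<omega> in M. S2 \<omega> \<ge> ennreal t)
    \<le> 4 * L * r * s * sqrt (real (card (supp \<beta>))) / (t * sqrt (real n))"
    unfolding S2_def using r_pos t_pos by (intro sup_dev_support_tail) auto
  with S S1 S2 tail tail1 show ?thesis by blast
qed

end
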